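(* Let $T$ be a rank-one transformation that grows exponentially and has a bounded number of cuts. Then $T$ is weakly rationally ergodic; that is, there exists a measurable set $F\subset X$ with $0<\mu(F)<\infty$ such that for all measurable $A,B\subset F$, $$\frac{1}{a_n(F)}\sum_{k=0}^{n-1}\mu(A\cap T^kB)\longrightarrow \mu(A)\mu(B)\qquad (n\to\infty).$$
   Context: Rank-one transformations. A column is a finite ordered collection of pairwise disjoint intervals of $\mathbb{R}$ (called levels), all of the same length, thought of as stacked on top of each other. The column map $T_C$ of a column $C$ sends each point of a level other than the top one to the point directly above it in the next level (by translation); it is undefined on the top level. A rank-one (cutting-and-stacking) transformation $T$ is given by a sequence of columns $C_n$, $n\ge 0$: $C_0$ consists of the single level $I=(0,1)$; $C_{n+1}$ is obtained from $C_n$ by cutting $C_n$ into $r_n\ge 2$ subcolumns of equal width (numbered $0,\dots,r_n-1$ from left to right), adding $s_{n,k}\ge 0$ new levels ("spacers", new disjoint intervals) above the $k$-th subcolumn, and stacking every subcolumn under the subcolumn to its right. $X$ is the union of all levels of all columns, with Lebesgue measure $\mu$ and its Borel $\sigma$-algebra, and the levels are required to form a generating semiring for the $\sigma$-algebra. $T_{C_{n+1}}$ extends $T_{C_n}$, and $T$ is the limit of the $T_{C_n}$; it is an invertible measure-preserving transformation of $X$ (mod null sets). $h_n$ denotes the number of levels of $C_n$. $T$ grows exponentially if $2s_{n,r_n-1}\ge h_{n+1}$ for every $n$. $T$ has a bounded number of cuts if $\sup_n r_n<\infty$. For measurable $F$ with $0<\mu(F)<\infty$, $u_k(F)=\mu(F\cap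 T^kF)/\mu(F)^2$ and $a_n(F)=\sum_{k=0}^{n-1}u_k(F)$. *)

theory Defs
  imports "HOL-Analysis.Analysis"
begin

text \<open>
  All levels of a column are open intervals of one length \<open>width\<close>, so a column is
  recorded by that length and the list of left endpoints of its levels, from bottom to top.
\<close>

record column =
  width :: real
  lefts :: "real list"

definition height :: "column \<Rightarrow> nat" where
  "height c = length (lefts c)"

definition level :: "column \<Rightarrow> nat \<Rightarrow> real set" where
  "level c i = {lefts c ! i <..< lefts c ! i + width c}"

definition is_column :: "column \<Rightarrow> bool" where
  "is_column c \<longleftrightarrow> width c > 0 \<and> height c > 0 \<and>
     (\<forall>i<height c. \<forall>j<height c. i \<noteq> j \<longrightarrow> level c i \<inter> level c j = {})"

definition column_map :: "column \<Rightarrow> real \<rightharpoonup> real" where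
  "column_map c x =
     (if \<exists>i. Suc i < height c \<and> x \<in> level c i
      then let i = (THE i. Suc i < height c \<and> x \<in> level c i)
           in Some (x + (lefts c ! Suc i - lefts c ! i))
      else None)"

text \<open>
  The column obtained from \<open>c\<close> by cutting it into \<open>r\<close> subcolumns and placing, above the
  \<open>k\<close>-th one, the spacers with left endpoints \<open>sp k\<close> (also listed from bottom to top).
\<close>

definition cut_and_stack :: "nat \<Rightarrow> (nat \<Rightarrow> real list) \<Rightarrow> column \<Rightarrow> column" where
  "cut_and_stack r sp c =
     \<lparr> width = width c / real r,
       lefts = concat (map (\<lambda>k. map (\<lambda>a. a + real k * (width c / real r)) (lefts c) @ sp k) [0..<r]) \<rparr>"

definition levels :: "(nat \<Rightarrow> column) \<Rightarrow> real set set" where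
  "levels C = {level (C n) i | n i. i < height (C n)}"

definition rank_one_space :: "(nat \<Rightarrow> column) \<Rightarrow> real measure" where
  "rank_one_space C = restrict_space lborel (\<Union>(levels C))"

text \<open>
  Since cutting an open interval into open intervals loses the cut points, the semiring and
  generation properties are understood modulo null sets.
\<close>

definition generating_semiring_mod_null :: "'a measure \<Rightarrow> 'a set set \<Rightarrow> bool" where
  "generating_semiring_mod_null M L \<longleftrightarrow>
     L \<subseteq> sets M \<and>
     (\<forall>A\<in>L. \<forall>B\<in>L. A \<inter> B \<in> insert {} L) \<and>
     (\<forall>A\<in>L. \<forall>B\<in>L. \<exists>D\<subseteq>L. finite D \<and> disjoint D \<and> sym_diff (A - B) (\<Union>D) \<in> null_sets M) \<and>
     (\<forall>B\<in>sets M. \<exists>B'\<in>sigma_sets (space M) L. sym_diff B B' \<in> null_sets M)"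

text \<open>
  That the spacers are new, i.e. disjoint from each other and from the levels of \<open>C n\<close>, is
  expressed by \<open>is_column (C (Suc n))\<close>: an open interval that misses all open pieces of a
  level misses the level.
\<close>

definition rank_one_construction ::
    "(nat \<Rightarrow> nat) \<Rightarrow> (nat \<Rightarrow> nat \<Rightarrow> nat) \<Rightarrow> (nat \<Rightarrow> column) \<Rightarrow> bool" where
  "rank_one_construction r s C \<longleftrightarrow>
     C 0 = \<lparr> width = 1, lefts = [0] \<rparr> \<and>
     (\<forall>n. is_column (C n)) \<and>
     (\<forall>n. r n \<ge> 2) \<and>
     (\<forall>n. \<exists>sp. (\<forall>k<r n. length (sp k) = s n k) \<and> C (Suc n) = cut_and_stack (r n) sp (C n)) \<and>
     generating_semiring_mod_null (rank_one_space C) (levels C)"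

text \<open>
  The limit of the column maps, i.e. the function whose graph is the union of their graphs.
  (At a cut point only finitely many of the column maps are defined; they agree there.)
  Where no column map is defined, the value is set to \<open>x\<close>; within the space this concerns
  at most a null set.
\<close>

definition rank_one_map :: "(nat \<Rightarrow> column) \<Rightarrow> real \<Rightarrow> real" where
  "rank_one_map C x =
     (if \<exists>n y. column_map (C n) x = Some y
      then (THE y. \<exists>n. column_map (C n) x = Some y)
      else x)"

definition grows_exponentially ::
    "(nat \<Rightarrow> nat) \<Rightarrow> (nat \<Rightarrow> nat \<Rightarrow> nat) \<Rightarrow> (nat \<Rightarrow> column) \<Rightarrow> bool" where
  "grows_exponentially r s C \<longleftrightarrow> (\<forall>n. 2 * s n (r n - 1) \<ge> height (C (Suc n)))"

definition bounded_cuts :: "(nat \<Rightarrow> nat) \<Rightarrow> bool" where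
  "bounded_cuts r \<longleftrightarrow> bdd_above (range r)"

definition intersection_rate :: "'a measure \<Rightarrow> ('a \<Rightarrow> 'a) \<Rightarrow> 'a set \<Rightarrow> nat \<Rightarrow> real" where
  "intersection_rate M T F k = measure M (F \<inter> (T ^^ k) ` F) / (measure M F)\<^sup>2"

definition return_sequence :: "'a measure \<Rightarrow> ('a \<Rightarrow> 'a) \<Rightarrow> 'a set \<Rightarrow> nat \<Rightarrow> real" where
  "return_sequence M T F n = (\<Sum>k<n. intersection_rate M T F k)"

definition weakly_rationally_ergodic :: "'a measure \<Rightarrow> ('a \<Rightarrow> 'a) \<Rightarrow> bool" where
  "weakly_rationally_ergodic M T \<longleftrightarrow>
     (\<exists>F\<in>sets M. 0 < emeasure M F \<and> emeasure M F < \<infinity> \<and>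
        (\<forall>A\<in>sets M. \<forall>B\<in>sets M. A \<subseteq> F \<longrightarrow> B \<subseteq> F \<longrightarrow>
           (\<lambda>n. 1 / return_sequence M T F n * (\<Sum>k<n. measure M (A \<inter> (T ^^ k) ` B)))
             \<longlonglongrightarrow> measure M A * measure M B))"

end

theory Submission imports Defs begin

text \<open>
  Take \<open>F = (0, 1)\<close>. Since the upper half of every column consists of spacers, all the orbits
  that start in \<open>F\<close> and have length \<open>k \<le> h\<^sub>n / 2\<close> stay inside \<open>C\<^sub>n\<close> and visit \<open>F\<close> at most
  \<open>p\<^sub>n = r\<^sub>0 \<cdots> r\<^bsub>n-1\<^esub>\<close> times, while \<open>a\<^sub>k \<ge> p\<^bsub>n-1\<^esub> / 2\<close> as soon as \<open>k \<ge> h\<^bsub>n-1\<^esub> / 2\<close>. With boundedly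
  many cuts these bounds are comparable, so the normalized correlations of \<open>A\<close> and \<open>B\<close> are at
  most a constant times \<open>\<mu>(A)\<close> and a constant times \<open>\<mu>(B)\<close>, and it suffices to treat levels.
  Two levels of a fixed column are translates of each other by a bounded power of \<open>T\<close>, so
  the unnormalized correlations of any two pairs of levels differ by a bounded amount; as those of all
  pairs in \<open>F\<close> add up to \<open>a\<^sub>k \<rightarrow> \<infinity>\<close>, each pair has the same share of \<open>a\<^sub>k\<close> in the limit.
\<close>

section \<open>Cut points, and copies of a column inside another column\<close>

lemma level_nonempty: "width c > 0 \<Longrightarrow> level c i \<noteq> {}"
  by (simp add: level_def)

lemma open_level [simp]: "open (level c i)"
  by (simp add: level_def)

lemma level_eqD:
  assumes "is_column c" "i < height c" "j < height c" "level c i \<inter> level c j \<noteq> {}"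
  shows "i = j"
  using assms unfolding is_column_def by blast

text \<open>Cutting an open level loses finitely many cut points, whereas a nonempty open set of
  reals is infinite and cannot be swallowed by them.\<close>

lemma open_diff_finite_nonempty:
  fixes S :: "real set"
  assumes "open S" "S \<noteq> {}" "finite (S - V)"
  shows "S \<inter> V \<noteq> {}"
proof
  assume "S \<inter> V = {}"
  then have "S - V = S" by blast
  then show False using assms finite_imp_not_open by auto
qed

text \<open>
  \<open>copies c d Q\<close>: the members of \<open>Q\<close> are the positions in \<open>d\<close> of the bottom levels of the
  copies of \<open>c\<close> into which \<open>c\<close> has been cut.
\<close>

definition copies :: "column \<Rightarrow> column \<Rightarrow> nat set \<Rightarrow> bool" where
  "copies c d Q \<longleftrightarrow> finite Q \<and>
     (\<forall>q\<in>Q. \<forall>i<height c. q + i < height d \<and> level d (q + i) \<subseteq> level c i \<and>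
        lefts d ! (q + i) - lefts d ! q = lefts c ! i - lefts c ! 0) \<and>
     (\<forall>i<height c. finite (level c i - (\<Union>q\<in>Q. level d (q + i))))"

lemma copiesD:
  assumes "copies c d Q" "q \<in> Q" "i < height c"
  shows "q + i < height d" "level d (q + i) \<subseteq> level c i"
    and "lefts d ! (q + i) - lefts d ! q = lefts c ! i - lefts c ! 0"
  using assms by (auto simp: copies_def)

lemma copies_finite:
  assumes "copies c d Q"
  shows "finite Q" and "i < height c \<Longrightarrow> finite (level c i - (\<Union>q\<in>Q. level d (q + i)))"
  using assms by (auto simp: copies_def)

lemma copies_refl: "copies c c {0}"
  by (simp add: copies_def)

text \<open>Positions add up: the copy of \<open>d\<close> that starts at \<open>q'\<close> in
  \<open>e\<close> carries the copy of \<open>c\<close> that starts at \<open>q\<close> in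
  \<open>d\<close> to height \<open>q' + q\<close>. The cut points of both steps together are still
  finite in number.\<close>

lemma copies_trans:
  assumes "copies c d Q" "copies d e Q'"
  shows "copies c e ((\<lambda>(q', q). q' + q) ` (Q' \<times> Q))"
  unfolding copies_def
proof (intro conjI ballI allI impI)
  show "finite ((\<lambda>(q', q). q' + q) ` (Q' \<times> Q))"
    using assms copies_finite(1) by blast
next
  fix p i assume "p \<in> (\<lambda>(q', q). q' + q) ` (Q' \<times> Q)" and i: "i < height c"
  then obtain q' q where p: "p = q' + q" and q: "q' \<in> Q'" "q \<in> Q" by auto
  note d = copiesD[OF assms(1) q(2) i]
  note e = copiesD[OF assms(2) q(1)]
  show "p + i < height e" "level e (p + i) \<subseteq> level c i"
    using d(1,2) e(1,2)[OF d(1)] by (auto simp: p add.assoc)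
  have "q < height d" using d(1) by simp
  then show "lefts e ! (p + i) - lefts e ! p = lefts c ! i - lefts c ! 0"
    using d(3) e(3)[OF d(1)] e(3)[of q] by (simp add: p add.assoc)
next
  fix i assume i: "i < height c"
  have "finite (level c i - (\<Union>q\<in>Q. level d (q + i)))"
    using copies_finite(2)[OF assms(1) i] .
  moreover have "finite (\<Union>q\<in>Q. level d (q + i) - (\<Union>q'\<in>Q'. level e (q' + (q + i))))"
    using copies_finite[OF assms(1)] copies_finite(2)[OF assms(2)] copiesD(1)[OF assms(1) _ i]
    by (intro finite_UN_I) auto
  ultimately have "finite ((level c i - (\<Union>q\<in>Q. level d (q + i))) \<union>
      (\<Union>q\<in>Q. level d (q + i) - (\<Union>q'\<in>Q'. level e (q' + (q + i)))))" by simp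
  then show "finite (level c i - (\<Union>p\<in>(\<lambda>(q', q). q' + q) ` (Q' \<times> Q). level e (p + i)))"
    by (rule finite_subset[rotated]) (auto simp: add.assoc)
qed

text \<open>The overlap of the two levels is open, so it survives the removal of the cut points and
  meets some \<open>level d (q + i)\<close>; disjointness of the levels of \<open>d\<close> then
  forces \<open>j = q + i\<close>.\<close>

lemma copies_position:
  assumes "copies c d Q" "is_column d" "i < height c" "j < height d"
    and "level d j \<inter> level c i \<noteq> {}"
  obtains q where "q \<in> Q" "j = q + i"
proof -
  let ?V = "\<Union>q\<in>Q. level d (q + i)"
  have "finite (level c i - ?V)"
    using copies_finite(2)[OF assms(1,3)] .
  then have "finite (level d j \<inter> level c i - ?V)"
    by (rule finite_subset[rotated]) auto
  then have "level d j \<inter> level c i \<inter> ?V \<noteq> {}"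
    using open_diff_finite_nonempty[OF open_Int[OF open_level open_level] assms(5)] by blast
  then obtain q where q: "q \<in> Q" "level d j \<inter> level d (q + i) \<noteq> {}" by blast
  moreover have "q + i < height d"
    using copiesD(1)[OF assms(1) q(1) assms(3)] .
  ultimately show thesis
    using that level_eqD[OF assms(2,4)] by blast
qed

text \<open>The nonempty set \<open>level d (q + i)\<close> lies in \<open>level c i\<close> and in
  no other level of \<open>c\<close>, so the sum determines \<open>i\<close> and hence
  \<open>q\<close>.\<close>

lemma copies_inj:
  assumes "copies c d Q" "is_column c" "width d > 0"
  shows "inj_on (\<lambda>(q, i). q + i) (Q \<times> {..<height c})"
proof (rule inj_onI, clarsimp)
  fix p i q j assume *: "p \<in> Q" "i < height c" "q \<in> Q" "j < height c" "p + i = q + j"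
  have "level d (p + i) \<subseteq> level c i" "level d (p + i) \<subseteq> level c j"
    using copiesD(2)[OF assms(1)] * by metis+
  then have "level c i \<inter> level c j \<noteq> {}"
    using level_nonempty[OF assms(3), of "p + i"] by blast
  then have "i = j" using level_eqD[OF assms(2)] * by blast
  then show "p = q \<and> i = j" using * by simp
qed

lemma nth_concat_take:
  assumes "k < length xss" "i < length (xss ! k)"
  shows "concat xss ! (length (concat (take k xss)) + i) = xss ! k ! i"
    and "length (concat (take k xss)) + i < length (concat xss)"
proof -
  have "concat xss = concat (take k xss @ xss ! k # drop (Suc k) xss)"
    using id_take_nth_drop[OF assms(1)] by simp
  then have *: "concat xss = concat (take k xss) @ xss ! k @ concat (drop (Suc k) xss)"
    by simp
  show "concat xss ! (length (concat (take k xss)) + i) = xss ! k ! i"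
    by (subst *) (simp add: nth_append assms)
  show "length (concat (take k xss)) + i < length (concat xss)"
    unfolding * using assms(2) by simp
qed

lemma interval_cut_points:
  fixes a w x :: real
  assumes "w > 0" "r > 0" "x \<in> {a<..<a + w}"
    and "\<And>k. k < r \<Longrightarrow> x \<notin> {a + real k * (w / r)<..<a + real k * (w / r) + w / r}"
  shows "x \<in> (\<lambda>k. a + real k * (w / r)) ` {..r}"
proof -
  define u where "u = w / real r"
  have u: "u > 0" "real r * u = w" using assms by (auto simp: u_def)
  \<comment> \<open>The number of the piece that contains \<open>x\<close> when left endpoints are
    included; as \<open>x\<close> avoids the open piece, it must be that endpoint.\<close>
  define k where "k = nat \<lfloor>(x - a) / u\<rfloor>"
  have "(x - a) / u \<ge> 0" using u assms by auto
  then have k: "real k \<le> (x - a) / u" "(x - a) / u < real k + 1"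
    unfolding k_def by linarith+
  have k1: "real k * u \<le> x - a" "x - a < real k * u + u"
    using k u by (simp_all add: field_simps)
  have "real k * u < real r * u" using k1 assms(3) u by auto
  then have "k < r" using mult_less_cancel_right_pos[OF u(1)] by simp
  then have "x = a + real k * u"
    using assms(4)[of k] k1 unfolding u_def[symmetric] by auto
  then show ?thesis using \<open>k < r\<close> by (auto simp: u_def)
qed

text \<open>The second conclusion records that every copy has at least the spacers of the last
  subcolumn above it; exponential growth is applied to exactly this room.\<close>

lemma copies_cut_and_stack:
  assumes c: "is_column c" and r: "r > 0"
  obtains Q where "copies c (cut_and_stack r sp c) Q"
    and "\<And>q. q \<in> Q \<Longrightarrow> q + height c + length (sp (r - 1)) \<le> height (cut_and_stack r sp c)"
proof -
  define d where "d = cut_and_stack r sp c"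
  define u where "u = width c / real r"
  define xss where "xss = map (\<lambda>k. map (\<lambda>a. a + real k * u) (lefts c) @ sp k) [0..<r]"
  \<comment> \<open>The height at which the \<open>k\<close>-th subcolumn starts.\<close>
  define st where "st k = length (concat (take k xss))" for k
  have len: "length xss = r" by (simp add: xss_def)
  have nth: "xss ! k = map (\<lambda>a. a + real k * u) (lefts c) @ sp k" if "k < r" for k
    using that by (simp add: xss_def)
  have d: "width d = u" "lefts d = concat xss"
    by (simp_all add: d_def u_def xss_def cut_and_stack_def)
  have w: "width c > 0" and u: "u > 0" using c r by (auto simp: is_column_def u_def)
  have pos: "st k + i < height d" "lefts d ! (st k + i) = lefts c ! i + real k * u"
    if "k < r" "i < height c" for k i
    using nth_concat_take[of k xss i] that
    by (simp_all add: len nth d height_def st_def nth_append)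
  have lev: "level d (st k + i) = {lefts c ! i + real k * u <..< lefts c ! i + real k * u + u}"
    if "k < r" "i < height c" for k i
    using pos[OF that] by (simp add: level_def d)
  have sub: "level d (st k + i) \<subseteq> level c i" if "k < r" "i < height c" for k i
  proof -
    have "(real k + 1) * u \<le> real r * u" using that u by (intro mult_right_mono) auto
    also have "\<dots> = width c" using r by (simp add: u_def)
    finally have "real k * u + u \<le> width c" by (simp add: algebra_simps)
    moreover have "real k * u \<ge> 0" using u by simp
    ultimately show ?thesis
      unfolding lev[OF that] by (simp add: level_def greaterThanLessThan_subseteq_greaterThanLessThan)
  qed
  have h0: "0 < height c" using c by (simp add: is_column_def)
  have "copies c d (st ` {..<r})"
    unfolding copies_def
  proof (intro conjI ballI allI impI)
    fix q i assume "q \<in> st ` {..<r}" and i: "i < height c"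
    then obtain k where k: "k < r" "q = st k" by auto
    show "q + i < height d" "level d (q + i) \<subseteq> level c i"
      using pos sub k i by auto
    show "lefts d ! (q + i) - lefts d ! q = lefts c ! i - lefts c ! 0"
      using pos(2)[OF k(1) i] pos(2)[OF k(1) h0] k by simp
  next
    fix i assume i: "i < height c"
    have "level c i - (\<Union>q\<in>st ` {..<r}. level d (q + i))
      \<subseteq> (\<lambda>k. lefts c ! i + real k * (width c / r)) ` {..r}"
    proof
      fix x assume x: "x \<in> level c i - (\<Union>q\<in>st ` {..<r}. level d (q + i))"
      have "x \<notin> {lefts c ! i + real k * u <..< lefts c ! i + real k * u + u}" if "k < r" for k
        using x that lev[OF that i] by blast
      moreover have "x \<in> {lefts c ! i <..< lefts c ! i + width c}"
        using x by (simp add: level_def)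
      ultimately show "x \<in> (\<lambda>k. lefts c ! i + real k * (width c / r)) ` {..r}"
        using interval_cut_points[OF w r] unfolding u_def by blast
    qed
    then show "finite (level c i - (\<Union>q\<in>st ` {..<r}. level d (q + i)))"
      using finite_surj[OF finite_atMost] by blast
  qed simp
  moreover have "q + height c + length (sp (r - 1)) \<le> height d" if q: "q \<in> st ` {..<r}" for q
  proof -
    obtain k where k: "k < r" "q = st k" using q by auto
    have "concat xss = concat (take k xss @ xss ! k # drop (Suc k) xss)"
      using id_take_nth_drop[of k xss] k by (simp add: len)
    then have *: "height d = q + height c + length (sp k) + length (concat (drop (Suc k) xss))"
      using k by (simp add: d height_def st_def nth)
    show ?thesis
    proof (cases "k = r - 1")
      case True
      then show ?thesis using * by simp
    next
      case False
      \<comment> \<open>The last subcolumn, with its spacers, is among those stacked above the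
        \<open>k\<close>-th one.\<close>
      then have "Suc k + (r - 1 - Suc k) = r - 1" using k by simp
      then have "drop (Suc k) xss ! (r - 1 - Suc k) = xss ! (r - 1)"
        using nth_drop[of "Suc k" xss "r - 1 - Suc k"] k unfolding len by (simp only: Suc_leI)
      moreover have "r - 1 - Suc k < length (drop (Suc k) xss)" using k False by (simp add: len)
      ultimately have "xss ! (r - 1) \<in> set (drop (Suc k) xss)" by (metis nth_mem)
      then have "length (xss ! (r - 1)) \<le> length (concat (drop (Suc k) xss))"
        by (simp add: length_concat member_le_sum_list)
      moreover have "length (xss ! (r - 1)) \<ge> length (sp (r - 1))" using r by (simp add: nth)
      ultimately show ?thesis using * by simp
    qed
  qed
  ultimately show thesis using that d_def by blast
qed

section \<open>The column maps and their limit\<close>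

lemma column_map_level:
  assumes "is_column c" "Suc i < height c" "x \<in> level c i"
  shows "column_map c x = Some (x + (lefts c ! Suc i - lefts c ! i))"
proof -
  have "(THE i. Suc i < height c \<and> x \<in> level c i) = i"
    using assms level_eqD[OF assms(1) Suc_lessD Suc_lessD]
    by (intro the_equality conjI) blast+
  moreover have "\<exists>i. Suc i < height c \<and> x \<in> level c i" using assms by blast
  ultimately show ?thesis by (simp add: column_map_def)
qed

lemma column_map_SomeE:
  assumes "is_column c" "column_map c x = Some y"
  obtains i where "Suc i < height c" "x \<in> level c i" "y = x + (lefts c ! Suc i - lefts c ! i)"
proof -
  obtain i where i: "Suc i < height c" "x \<in> level c i"
    using assms(2) by (auto simp: column_map_def split: if_splits)
  then show thesis using that column_map_level[OF assms(1) i] assms(2) by auto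
qed

locale rank_one =
  fixes r :: "nat \<Rightarrow> nat" and s :: "nat \<Rightarrow> nat \<Rightarrow> nat" and C :: "nat \<Rightarrow> column"
  assumes construction: "rank_one_construction r s C"
begin

lemma column: "is_column (C n)"
  using construction by (simp add: rank_one_construction_def)

lemma width_pos: "width (C n) > 0" and height_pos: "height (C n) > 0"
  using column by (auto simp: is_column_def)

lemma cuts: "r n \<ge> 2"
  using construction by (simp add: rank_one_construction_def)

lemma column_Suc:
  obtains sp where "\<And>k. k < r n \<Longrightarrow> length (sp k) = s n k" "C (Suc n) = cut_and_stack (r n) sp (C n)"
  using construction unfolding rank_one_construction_def by metis

lemma width_Suc: "width (C (Suc n)) = width (C n) / r n"
proof -
  obtain sp where "C (Suc n) = cut_and_stack (r n) sp (C n)"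
    using column_Suc by metis
  then show ?thesis by (simp add: cut_and_stack_def)
qed

lemma copies_Suc:
  obtains Q where "copies (C n) (C (Suc n)) Q"
    "\<And>q. q \<in> Q \<Longrightarrow> q + height (C n) + s n (r n - 1) \<le> height (C (Suc n))"
proof -
  obtain sp where sp: "\<And>k. k < r n \<Longrightarrow> length (sp k) = s n k"
      "C (Suc n) = cut_and_stack (r n) sp (C n)"
    using column_Suc by metis
  have r: "r n > 0" using cuts[of n] by simp
  obtain Q where "copies (C n) (cut_and_stack (r n) sp (C n)) Q"
      "\<And>q. q \<in> Q \<Longrightarrow>
         q + height (C n) + length (sp (r n - 1)) \<le> height (cut_and_stack (r n) sp (C n))"
    using copies_cut_and_stack[OF column r] by blast
  then show thesis
    using that[of Q] sp r by simp
qed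

text \<open>An intrinsic description of the copies of \<open>C m\<close> in \<open>C n\<close>, free
  of the intermediate cuts; by \<open>positionsI\<close> it equals every \<open>Q\<close> that
  satisfies \<open>copies\<close>.\<close>

definition positions :: "nat \<Rightarrow> nat \<Rightarrow> nat set" where
  "positions m n = {j. j < height (C n) \<and> level (C n) j \<subseteq> level (C m) 0}"

lemma positionsI:
  assumes "copies (C m) (C n) Q"
  shows "positions m n = Q"
proof (intro equalityI subsetI)
  fix j assume "j \<in> positions m n"
  then have j: "j < height (C n)" "level (C n) j \<inter> level (C m) 0 \<noteq> {}"
    using level_nonempty[OF width_pos] by (auto simp: positions_def)
  then show "j \<in> Q"
    using copies_position[OF assms column height_pos] by auto
next
  fix j assume "j \<in> Q"
  then show "j \<in> positions m n"
    using copiesD(1,2)[OF assms _ height_pos[of m], of j] by (simp add: positions_def)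
qed

lemma copies:
  assumes "m \<le> n"
  shows "copies (C m) (C n) (positions m n)"
  using assms
proof (induction n rule: dec_induct)
  case base
  show ?case using copies_refl positionsI[OF copies_refl] by simp
next
  case (step n)
  obtain Q where "copies (C n) (C (Suc n)) Q" using copies_Suc by metis
  from copies_trans[OF step.IH this] show ?case using positionsI by simp
qed

lemma finite_positions [simp]: "finite (positions m n)"
  by (simp add: positions_def)

text \<open>Two column maps agree where both are defined, because within each copy of an earlier
  column the left endpoints keep their differences. So the value picked by \<open>THE\<close> is
  unique.\<close>

lemma rank_one_map_level:
  assumes "Suc i < height (C n)" "x \<in> level (C n) i"
  shows "rank_one_map C x = x + (lefts (C n) ! Suc i - lefts (C n) ! i)"
proof -
  have le: "y = y'" if "m \<le> n" and y: "column_map (C m) x = Some y" "column_map (C n) x = Some y'"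
    for m n y y'
  proof -
    obtain i where i: "Suc i < height (C m)" "x \<in> level (C m) i"
        "y = x + (lefts (C m) ! Suc i - lefts (C m) ! i)"
      using column_map_SomeE[OF column] y(1) by metis
    obtain j where j: "Suc j < height (C n)" "x \<in> level (C n) j"
        "y' = x + (lefts (C n) ! Suc j - lefts (C n) ! j)"
      using column_map_SomeE[OF column] y(2) by metis
    obtain q where q: "q \<in> positions m n" "j = q + i"
      using copies_position[OF copies[OF \<open>m \<le> n\<close>] column, of i j] i j by auto
    have "i < height (C m)" using i by simp
    with copiesD(3)[OF copies[OF \<open>m \<le> n\<close>] q(1), of i] copiesD(3)[OF copies[OF \<open>m \<le> n\<close>] q(1), of "Suc i"]
    show ?thesis using i j q by simp
  qed
  have eq: "y = y'" if "column_map (C m) x = Some y" "column_map (C n) x = Some y'" for m n y y'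
    using le[OF _ that] le[OF _ that(2,1)] nat_le_linear by metis
  let ?y = "x + (lefts (C n) ! Suc i - lefts (C n) ! i)"
  have y: "column_map (C n) x = Some ?y"
    using column_map_level[OF column assms] .
  then have "(THE y. \<exists>n. column_map (C n) x = Some y) = ?y"
    using eq[OF _ y] by (intro the_equality) blast+
  moreover have "\<exists>n y. column_map (C n) x = Some y" using y by blast
  ultimately show ?thesis unfolding rank_one_map_def by simp
qed

text \<open>The successive translations telescope as long as the orbit does not pass the top
  level.\<close>

lemma funpow_rank_one_map_level:
  assumes "i + k < height (C n)" "x \<in> level (C n) i"
  shows "(rank_one_map C ^^ k) x = x + (lefts (C n) ! (i + k) - lefts (C n) ! i)"
  using assms
proof (induction k)
  case (Suc k)
  let ?x = "x + (lefts (C n) ! (i + k) - lefts (C n) ! i)"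
  have "?x \<in> level (C n) (i + k)" using Suc by (auto simp: level_def)
  then have "rank_one_map C ?x = ?x + (lefts (C n) ! Suc (i + k) - lefts (C n) ! (i + k))"
    using Suc.prems by (intro rank_one_map_level) auto
  then show ?case using Suc by simp
qed simp

end

subsection \<open>Correlations inside a column\<close>

text \<open>The points of heights \<open>i\<close> and \<open>j\<close> on one vertical line that lie in \<open>B\<close> and \<open>A\<close>, respectively.\<close>

definition cross_set :: "column \<Rightarrow> nat \<Rightarrow> nat \<Rightarrow> real set \<Rightarrow> real set \<Rightarrow> real set" where
  "cross_set c i j A B = {t \<in> {0<..<width c}. lefts c ! j + t \<in> A \<and> lefts c ! i + t \<in> B}"

definition cross :: "column \<Rightarrow> nat \<Rightarrow> nat \<Rightarrow> real set \<Rightarrow> real set \<Rightarrow> real" where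
  "cross c i j A B = measure lborel (cross_set c i j A B)"

lemma measure_lborel_translate:
  fixes A :: "real set"
  assumes "A \<in> sets borel"
  shows "(+) a ` A \<in> sets borel" "measure lborel ((+) a ` A) = measure lborel A"
proof -
  have eq: "(+) a ` A = (\<lambda>x. - a + x) -` A \<inter> space lborel"
    by (auto simp: image_iff intro!: bexI[of _ "- a + x" for x])
  have m: "(\<lambda>x. - a + x) \<in> lborel \<rightarrow>\<^sub>M borel" by simp
  show "(+) a ` A \<in> sets borel"
    unfolding eq using measurable_sets[OF m assms] by (simp only: sets_lborel)
  have "measure (distr lborel borel ((+) (- a))) A = measure lborel A"
    using lborel_distr_plus[of "- a"] by metis
  then show "measure lborel ((+) a ` A) = measure lborel A"
    unfolding eq using measure_distr[OF m assms] by metis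
qed

lemma emeasure_lborel_bounded:
  assumes "A \<subseteq> {a<..<b::real}"
  shows "emeasure lborel A < \<infinity>"
  using assms emeasure_mono[of A "{a<..<b}" lborel] emeasure_lborel_Ioo[of a b]
  by (cases "a \<le> b") (auto intro: le_less_trans)

lemma emeasure_subset_level: "A \<subseteq> level c i \<Longrightarrow> emeasure lborel A \<noteq> \<infinity>"
  using emeasure_lborel_bounded unfolding level_def by (metis less_irrefl)

lemma measure_Un_finite_lborel:
  fixes A E :: "real set"
  assumes "A \<in> sets borel" "finite E"
  shows "measure lborel (A \<union> E) = measure lborel A"
  using assms by (intro measure_Un_null_set) (auto intro: finite_imp_null_set_lborel)

lemma sets_level [measurable]: "level c i \<in> sets borel"
  by (simp add: level_def)

lemma measure_level: "width c > 0 \<Longrightarrow> measure lborel (level c i) = width c"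
  by (simp add: level_def)

lemma cross_set_measurable [measurable]:
  assumes [measurable]: "A \<in> sets borel" "B \<in> sets borel"
  shows "cross_set c i j A B \<in> sets borel"
  unfolding cross_set_def by measurable

lemma cross_set_finite: "emeasure lborel (cross_set c i j A B) < \<infinity>"
  by (rule emeasure_lborel_bounded[of _ 0 "width c"]) (auto simp: cross_set_def)

lemma cross_set_sym: "cross_set c i j A B = cross_set c j i B A"
  by (auto simp: cross_set_def)

lemma cross_sym: "cross c i j A B = cross c j i B A"
  by (simp add: cross_def cross_set_sym)

lemma cross_set_translate_subset: "(+) (lefts c ! j) ` cross_set c i j A B \<subseteq> A \<inter> level c j"
  by (auto simp: cross_set_def level_def)

lemma cross_nonneg: "0 \<le> cross c i j A B"
  by (simp add: cross_def)

text \<open>Moved up to level \<open>j\<close>, the cross set becomes a part of \<open>A\<close> in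
  that level, and translation preserves the measure.\<close>

lemma cross_le:
  assumes "A \<in> sets borel" "B \<in> sets borel"
  shows "cross c i j A B \<le> measure lborel (A \<inter> level c j)"
proof -
  have "cross c i j A B = measure lborel ((+) (lefts c ! j) ` cross_set c i j A B)"
    using assms by (simp add: cross_def measure_lborel_translate)
  also have "\<dots> \<le> measure lborel (A \<inter> level c j)"
  proof (rule measure_mono_fmeasurable[OF cross_set_translate_subset])
    show "(+) (lefts c ! j) ` cross_set c i j A B \<in> sets lborel"
      using assms by (simp add: measure_lborel_translate)
    show "A \<inter> level c j \<in> fmeasurable lborel"
      using assms emeasure_lborel_bounded[of "A \<inter> level c j" "lefts c ! j" "lefts c ! j + width c"]
      by (intro fmeasurableI) (auto simp: level_def)
  qed
  finally show ?thesis .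
qed

lemma cross_sums:
  assumes "range A \<subseteq> sets borel" "B \<in> sets borel" "disjoint_family A"
  shows "(\<lambda>k. cross c i j (A k) B) sums cross c i j (\<Union>k. A k) B"
proof -
  have eq: "cross_set c i j (\<Union>k. A k) B = (\<Union>k. cross_set c i j (A k) B)"
    by (auto simp: cross_set_def)
  have "emeasure lborel (cross_set c i j (\<Union>k. A k) B) \<noteq> \<infinity>"
    using cross_set_finite[of c i j] by (simp add: less_top)
  then show ?thesis
    unfolding cross_def eq
    using assms by (intro measure_UNION) (auto simp: disjoint_family_on_def cross_set_def[of _ _ _ "A _"])
qed

lemma cross_levels:
  assumes "width c > 0" "level c j \<subseteq> A" "level c i \<subseteq> B"
  shows "cross c i j A B = width c"
proof -
  have "cross_set c i j A B = {0<..<width c}"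
    using assms by (auto simp: cross_set_def level_def)
  then show ?thesis using assms by (simp add: cross_def)
qed

lemma cross_disjoint:
  assumes "level c j \<inter> A = {} \<or> level c i \<inter> B = {}"
  shows "cross c i j A B = 0"
proof -
  have "lefts c ! i + t \<in> level c i" if "0 < t" "t < width c" for i t
    using that by (simp add: level_def)
  then have "cross_set c i j A B = {}"
    using assms by (auto simp: cross_set_def)
  then show ?thesis by (simp add: cross_def)
qed

lemma cross_cong:
  assumes "A \<inter> level c j = A' \<inter> level c j" "B \<inter> level c i = B' \<inter> level c i"
  shows "cross c i j A B = cross c i j A' B'"
proof -
  have "lefts c ! j + t \<in> A \<longleftrightarrow> lefts c ! j + t \<in> A'"
    "lefts c ! i + t \<in> B \<longleftrightarrow> lefts c ! i + t \<in> B'" if "0 < t" "t < width c" for t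
  proof -
    have "lefts c ! i + t \<in> level c i" for i using that by (simp add: level_def)
    then show "lefts c ! j + t \<in> A \<longleftrightarrow> lefts c ! j + t \<in> A'"
      "lefts c ! i + t \<in> B \<longleftrightarrow> lefts c ! i + t \<in> B'"
      using assms by blast+
  qed
  then have "cross_set c i j A B = cross_set c i j A' B'"
    by (simp add: cross_set_def cong: conj_cong Collect_cong)
  then show ?thesis by (simp add: cross_def)
qed

section \<open>Correlations of subsets of the base, computed in one column\<close>

context rank_one
begin

abbreviation base :: "real set" where
  "base \<equiv> level (C 0) 0"

lemma base_eq: "base = {0<..<1}" and height_0: "height (C 0) = 1"
  using construction by (simp_all add: rank_one_construction_def level_def height_def)

lemma positions_level:
  assumes "q \<in> positions 0 n"
  shows "q < height (C n)" "level (C n) q \<subseteq> base"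
  using assms by (auto simp: positions_def)

lemma level_disjoint:
  assumes "i < height (C n)" "j < height (C n)" "i \<noteq> j"
  shows "level (C n) i \<inter> level (C n) j = {}"
  using column[of n] assms unfolding is_column_def by blast

text \<open>Up to cut points, the bottom level of \<open>C m\<close> is the disjoint union of its
  pieces in \<open>C n\<close>, so their lengths add up to its own.\<close>

lemma card_positions:
  assumes "m \<le> n"
  shows "real (card (positions m n)) * width (C n) = width (C m)"
proof -
  let ?Q = "positions m n" and ?V = "\<Union>q\<in>positions m n. level (C n) q"
  note cp = copies[OF assms]
  have fin: "finite (level (C m) 0 - ?V)"
    using copies_finite(2)[OF cp height_pos] by simp
  have "?V \<subseteq> level (C m) 0" by (auto simp: positions_def)
  then have "measure lborel (level (C m) 0) = measure lborel (?V \<union> (level (C m) 0 - ?V))"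
    by (simp add: Un_absorb1)
  also have "\<dots> = measure lborel ?V"
    by (intro measure_Un_finite_lborel fin) auto
  also have "\<dots> = (\<Sum>q\<in>?Q. measure lborel (level (C n) q))"
  proof (rule measure_finite_Union)
    show "disjoint_family_on (level (C n)) ?Q"
      using level_disjoint by (auto simp: disjoint_family_on_def positions_def)
    show "emeasure lborel (level (C n) q) \<noteq> \<infinity>" for q
      using width_pos[of n] by (simp add: level_def)
  qed auto
  also have "\<dots> = card ?Q * width (C n)"
    by (simp add: measure_level width_pos)
  finally show ?thesis by (simp add: measure_level width_pos)
qed

lemma sum_measure_level_le:
  assumes "A \<in> sets borel"
  shows "(\<Sum>i\<in>positions 0 n. measure lborel (A \<inter> level (C n) i)) \<le> measure lborel (A \<inter> base)"
proof -
  have "(\<Sum>i\<in>positions 0 n. measure lborel (A \<inter> level (C n) i))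
      = measure lborel (\<Union>i\<in>positions 0 n. A \<inter> level (C n) i)"
  proof (rule measure_finite_Union[symmetric])
    show "disjoint_family_on (\<lambda>i. A \<inter> level (C n) i) (positions 0 n)"
      using level_disjoint positions_level(1) unfolding disjoint_family_on_def by blast
    show "emeasure lborel (A \<inter> level (C n) i) \<noteq> \<infinity>" for i
      using emeasure_subset_level[of "A \<inter> level (C n) i"] by blast
  qed (use assms in auto)
  also have "\<dots> \<le> measure lborel (A \<inter> base)"
  proof (rule measure_mono_fmeasurable)
    show "(\<Union>i\<in>positions 0 n. A \<inter> level (C n) i) \<subseteq> A \<inter> base"
      using positions_level(2) by blast
    show "A \<inter> base \<in> fmeasurable lborel"
      using assms emeasure_lborel_bounded[of "A \<inter> base" 0 1]
      by (intro fmeasurableI) (auto simp: base_eq)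
  qed (use assms in auto)
  finally show ?thesis .
qed

text \<open>The sum of the first \<open>k\<close> correlations as read off inside
  \<open>C n\<close>, with \<open>j - i\<close> as elapsed time. It is the true sum when
  \<open>k\<close> steps from a base level stay in the column
  (\<open>sum_measure_Int_funpow\<close>); as a finite sum over pairs of levels it is countably
  additive in each argument for every \<open>k\<close>.\<close>

definition corr :: "nat \<Rightarrow> nat \<Rightarrow> real set \<Rightarrow> real set \<Rightarrow> real" where
  "corr n k A B = (\<Sum>i\<in>positions 0 n. \<Sum>j\<in>positions 0 n.
     if i \<le> j \<and> j < i + k then cross (C n) i j A B else 0)"

lemma corr_nonneg: "0 \<le> corr n k A B"
  by (auto simp: corr_def cross_nonneg intro!: sum_nonneg)

text \<open>For fixed \<open>i\<close>, the terms are bounded by the portions of \<open>A\<close> in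
  disjoint levels of the base; the factor counts the \<open>i\<close>. In \<open>corr_le2\<close>
  the roles of \<open>i\<close> and \<open>j\<close> are exchanged.\<close>

lemma corr_le1:
  assumes "A \<in> sets borel" "B \<in> sets borel"
  shows "corr n k A B \<le> card (positions 0 n) * measure lborel (A \<inter> base)"
proof -
  have "corr n k A B \<le> (\<Sum>i\<in>positions 0 n. \<Sum>j\<in>positions 0 n. measure lborel (A \<inter> level (C n) j))"
    unfolding corr_def using cross_le[OF assms] by (intro sum_mono) auto
  also have "\<dots> \<le> (\<Sum>i\<in>positions 0 n. measure lborel (A \<inter> base))"
    using sum_measure_level_le[OF assms(1)] by (intro sum_mono)
  finally show ?thesis by simp
qed

lemma corr_le2:
  assumes "A \<in> sets borel" "B \<in> sets borel"
  shows "corr n k A B \<le> card (positions 0 n) * measure lborel (B \<inter> base)"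
proof -
  have "corr n k A B \<le> (\<Sum>i\<in>positions 0 n. \<Sum>j\<in>positions 0 n. measure lborel (B \<inter> level (C n) i))"
    unfolding corr_def
    using cross_le[OF assms(2,1)] by (intro sum_mono) (auto simp: cross_sym[of _ _ _ A])
  also have "\<dots> = (\<Sum>j\<in>positions 0 n. \<Sum>i\<in>positions 0 n. measure lborel (B \<inter> level (C n) i))"
    by (rule sum.swap)
  also have "\<dots> \<le> (\<Sum>j\<in>positions 0 n. measure lborel (B \<inter> base))"
    using sum_measure_level_le[OF assms(2)] by (intro sum_mono)
  finally show ?thesis by simp
qed

lemma corr_sums1:
  assumes "range A \<subseteq> sets borel" "B \<in> sets borel" "disjoint_family A"
  shows "(\<lambda>l. corr n k (A l) B) sums corr n k (\<Union>l. A l) B"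
  unfolding corr_def using cross_sums[OF assms] by (intro sums_sum) auto

lemma corr_sums2:
  assumes "A \<in> sets borel" "range B \<subseteq> sets borel" "disjoint_family B"
  shows "(\<lambda>l. corr n k A (B l)) sums corr n k A (\<Union>l. B l)"
  unfolding corr_def
  using cross_sums[OF assms(2,1,3)] by (intro sums_sum) (auto simp: cross_sym[of _ _ _ A])

lemma corr_Int_base:
  "corr n k (A \<inter> base) (B \<inter> base) = corr n k A B"
proof -
  have "cross (C n) i j (A \<inter> base) (B \<inter> base) = cross (C n) i j A B"
    if "i \<in> positions 0 n" "j \<in> positions 0 n" for i j
    using positions_level(2)[OF that(1)] positions_level(2)[OF that(2)]
    by (intro cross_cong) auto
  then show ?thesis unfolding corr_def by (intro sum.cong) auto
qed

text \<open>Inside the column, the \<open>m\<close>-th power of the map translates level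
  \<open>i\<close> onto level \<open>i + m\<close>. Up to finitely many points, the intersection is
  therefore the disjoint union of the cross sets of the levels \<open>i\<close> and
  \<open>i + m\<close>, moved up to level \<open>i + m\<close>.\<close>

lemma measure_Int_funpow:
  assumes AB: "A \<in> sets borel" "B \<in> sets borel" "A \<subseteq> base" "B \<subseteq> base"
    and m: "\<And>i. i \<in> positions 0 n \<Longrightarrow> i + m < height (C n)"
  shows "measure lborel (A \<inter> (rank_one_map C ^^ m) ` B)
    = (\<Sum>i\<in>positions 0 n. if i + m \<in> positions 0 n then cross (C n) i (i + m) A B else 0)"
proof -
  let ?P = "positions 0 n" and ?T = "rank_one_map C ^^ m"
  define D where "D = {i \<in> ?P. i + m \<in> ?P}"
  define S where "S i = (+) (lefts (C n) ! (i + m)) ` cross_set (C n) i (i + m) A B" for i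
  define R where "R = (\<Union>i\<in>D. S i)"
  \<comment> \<open>The points of the base lost as cut points. If neither a point nor its image is
    in \<open>E\<close>, both lie on base levels of \<open>C n\<close> and the translation formula
    applies.\<close>
  define E where "E = base - (\<Union>q\<in>?P. level (C n) q)"
  have finE: "finite E"
    using copies_finite(2)[OF copies[of 0 n], of 0] height_pos[of 0] by (simp add: E_def)
  have finD: "finite D" by (simp add: D_def)
  have Ssub: "S i \<subseteq> A \<inter> level (C n) (i + m)" for i
    unfolding S_def by (rule cross_set_translate_subset)
  have "R \<subseteq> A \<inter> ?T ` B"
  proof
    fix y assume "y \<in> R"
    then obtain i t where i: "i \<in> ?P" and t: "t \<in> cross_set (C n) i (i + m) A B"
      and y: "y = lefts (C n) ! (i + m) + t" unfolding R_def S_def D_def by auto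
    let ?x = "lefts (C n) ! i + t"
    have "?x \<in> level (C n) i" "?x \<in> B" "y \<in> A"
      using t y by (auto simp: cross_set_def level_def)
    moreover have "?T ?x = y"
      using funpow_rank_one_map_level[OF m[OF i] \<open>?x \<in> level (C n) i\<close>] y by simp
    ultimately show "y \<in> A \<inter> ?T ` B" by blast
  qed
  moreover have "A \<inter> ?T ` B - R \<subseteq> E \<union> ?T ` E"
  proof
    fix y assume "y \<in> A \<inter> ?T ` B - R"
    then obtain x where y: "y \<in> A" "y = ?T x" "x \<in> B" "y \<notin> R" by blast
    show "y \<in> E \<union> ?T ` E"
    proof (rule ccontr)
      assume "y \<notin> E \<union> ?T ` E"
      then have "x \<notin> E" "y \<notin> E" using y by auto
      then obtain i j where i: "i \<in> ?P" "x \<in> level (C n) i" and j: "j \<in> ?P" "y \<in> level (C n) j"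
        using y AB unfolding E_def by blast
      have eq: "y = x + (lefts (C n) ! (i + m) - lefts (C n) ! i)"
        using funpow_rank_one_map_level[OF m[OF i(1)] i(2)] y by simp
      then have "y \<in> level (C n) (i + m)" using i by (auto simp: level_def)
      then have "j = i + m"
        using level_disjoint[OF positions_level(1)[OF j(1)] m[OF i(1)]] j(2) by blast
      then have "i \<in> D" using i j by (simp add: D_def)
      moreover have "x - lefts (C n) ! i \<in> cross_set (C n) i (i + m) A B"
        using i(2) y(1,3) eq by (auto simp: cross_set_def level_def algebra_simps)
      then have "lefts (C n) ! (i + m) + (x - lefts (C n) ! i) \<in> S i"
        unfolding S_def by (rule imageI)
      then have "y \<in> S i" by (simp add: eq algebra_simps)
      ultimately show False using y(4) by (auto simp: R_def)
    qed
  qed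
  moreover have "finite (E \<union> ?T ` E)" using finE by simp
  ultimately have eq: "A \<inter> ?T ` B = R \<union> (A \<inter> ?T ` B - R)" and fin: "finite (A \<inter> ?T ` B - R)"
    by (blast, metis finite_subset)
  have Sm: "S i \<in> sets borel" "measure lborel (S i) = cross (C n) i (i + m) A B" for i
    using AB by (simp_all add: S_def cross_def measure_lborel_translate)
  have "measure lborel (A \<inter> ?T ` B) = measure lborel R"
    by (subst eq, rule measure_Un_finite_lborel[OF _ fin]) (use Sm finD in \<open>auto simp: R_def\<close>)
  also have "\<dots> = (\<Sum>i\<in>D. measure lborel (S i))"
    unfolding R_def
  proof (rule measure_finite_Union[OF finD])
    have "i + m < height (C n)" if "i \<in> D" for i using m that by (simp add: D_def)
    then have "S i \<inter> S i' = {}" if "i \<in> D" "i' \<in> D" "i \<noteq> i'" for i i'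
    proof -
      have "level (C n) (i + m) \<inter> level (C n) (i' + m) = {}"
        using \<open>\<And>i. i \<in> D \<Longrightarrow> i + m < height (C n)\<close> that by (intro level_disjoint) auto
      then show ?thesis using Ssub[of i] Ssub[of i'] by blast
    qed
    then show "disjoint_family_on S D"
      unfolding disjoint_family_on_def by blast
    show "emeasure lborel (S i) \<noteq> \<infinity>" if "i \<in> D" for i
      using emeasure_subset_level[of "S i"] Ssub[of i] by blast
  qed (use Sm in auto)
  also have "\<dots> = (\<Sum>i\<in>?P. if i + m \<in> ?P then cross (C n) i (i + m) A B else 0)"
    unfolding Sm D_def by (rule sum.inter_filter) simp
  finally show ?thesis .
qed

lemma sum_measure_Int_funpow:
  assumes AB: "A \<in> sets borel" "B \<in> sets borel" "A \<subseteq> base" "B \<subseteq> base"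
    and k: "\<And>i. i \<in> positions 0 n \<Longrightarrow> i + k \<le> height (C n)"
  shows "(\<Sum>m<k. measure lborel (A \<inter> (rank_one_map C ^^ m) ` B)) = corr n k A B"
proof -
  let ?P = "positions 0 n"
  have "(\<Sum>m<k. measure lborel (A \<inter> (rank_one_map C ^^ m) ` B))
    = (\<Sum>m<k. \<Sum>i\<in>?P. if i + m \<in> ?P then cross (C n) i (i + m) A B else 0)"
  proof (intro sum.cong measure_Int_funpow AB refl)
    show "i + m < height (C n)" if "m \<in> {..<k}" "i \<in> positions 0 n" for m i
      using k[OF that(2)] that(1) by simp
  qed
  also have "\<dots> = (\<Sum>i\<in>?P. \<Sum>m<k. if i + m \<in> ?P then cross (C n) i (i + m) A B else 0)"
    by (rule sum.swap)
  also have "\<dots> = corr n k A B"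
    unfolding corr_def
  proof (rule sum.cong[OF refl])
    fix i
    have "(\<Sum>m<k. if i + m \<in> ?P then cross (C n) i (i + m) A B else 0)
      = (\<Sum>m\<in>{m\<in>{..<k}. i + m \<in> ?P}. cross (C n) i (i + m) A B)"
      by (rule sum.inter_filter[symmetric]) simp
    \<comment> \<open>For fixed \<open>i\<close>, the time \<open>m\<close> is exchanged for the
      level \<open>j = i + m\<close> that is reached.\<close>
    also have "\<dots> = (\<Sum>j\<in>{j\<in>?P. i \<le> j \<and> j < i + k}. cross (C n) i j A B)"
      by (rule sum.reindex_bij_witness[of _ "\<lambda>j. j - i" "\<lambda>m. i + m"]) auto
    also have "\<dots> = (\<Sum>j\<in>?P. if i \<le> j \<and> j < i + k then cross (C n) i j A B else 0)"
      by (rule sum.inter_filter) simp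
    finally show "(\<Sum>m<k. if i + m \<in> ?P then cross (C n) i (i + m) A B else 0)
      = (\<Sum>j\<in>?P. if i \<le> j \<and> j < i + k then cross (C n) i j A B else 0)" .
  qed
  finally show ?thesis .
qed

end

subsection \<open>Convergence on a generating semiring\<close>

text \<open>The summable bound makes the series converge uniformly in \<open>n\<close> by the
  Weierstrass test, so limit and sum may be exchanged.\<close>

lemma tendsto_sums_dominated:
  fixes f :: "nat \<Rightarrow> nat \<Rightarrow> real"
  assumes "\<And>n. f n sums F n" "\<And>i. (\<lambda>n. f n i) \<longlonglongrightarrow> g i" "g sums G"
    and "\<And>n i. \<bar>f n i\<bar> \<le> h i" "summable h"
  shows "F \<longlonglongrightarrow> G"
proof -
  have "uniform_limit UNIV (\<lambda>k n. \<Sum>i<k. f n i) (\<lambda>n. suminf (f n)) sequentially"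
    using assms(4,5) by (intro Weierstrass_m_test[of _ "\<lambda>i n. f n i" h]) auto
  then have u: "uniform_limit UNIV (\<lambda>k n. \<Sum>i<k. f n i) F sequentially"
    unfolding sums_unique[OF assms(1), symmetric] .
  show ?thesis
  proof (rule swap_uniform_limit'[OF _ _ u])
    show "\<forall>\<^sub>F k in sequentially. (\<lambda>n. \<Sum>i<k. f n i) \<longlonglongrightarrow> (\<Sum>i<k. g i)"
      using assms(2) by (intro always_eventually allI tendsto_sum) auto
    show "(\<lambda>k. \<Sum>i<k. g i) \<longlonglongrightarrow> G" using assms(3) by (simp add: sums_def)
  qed auto
qed

lemma countably_additive_Diff:
  fixes f :: "'a set \<Rightarrow> real"
  assumes add: "\<And>A. range A \<subseteq> sets M \<Longrightarrow> disjoint_family A \<Longrightarrow> (\<lambda>i. f (A i)) sums f (\<Union>i. A i)"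
    and A: "A \<in> sets M"
  shows "f (space M - A) = f (space M) - f A"
proof -
  \<comment> \<open>The empty sets form a disjoint family, and a constant series converges only if
    its terms vanish.\<close>
  have "(\<lambda>i::nat. f {}) sums f {}"
    using add[of "\<lambda>_. {}"] by (simp add: disjoint_family_on_def)
  then have 0: "f {} = 0"
    using summable_const_iff sums_summable by blast
  have "range (binaryset A (space M - A)) \<subseteq> sets M"
    using A by (auto simp: range_binaryset_eq)
  moreover have "disjoint_family (binaryset A (space M - A))"
    by (auto simp: disjoint_family_on_def binaryset_def)
  ultimately have "(\<lambda>i. f (binaryset A (space M - A) i)) sums f (A \<union> (space M - A))"
    using add by (metis UN_binaryset_eq)
  moreover have "A \<union> (space M - A) = space M" using sets.sets_into_space[OF A] by blast
  ultimately have "f (space M) = f A + f (space M - A)"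
    using binaryset_sums[of f A "space M - A"] 0 sums_unique2 by auto
  then show ?thesis by simp
qed

text \<open>
  The domination by a multiple of \<open>m\<close> makes convergence pass to countable disjoint unions,
  so Dynkin's lemma applies.
\<close>

lemma tendsto_of_generating_semiring:
  fixes \<nu> :: "nat \<Rightarrow> 'a set \<Rightarrow> real" and m :: "'a set \<Rightarrow> real"
  assumes gen: "generating_semiring_mod_null M L"
    and add: "\<And>n A. range A \<subseteq> sets M \<Longrightarrow> disjoint_family A \<Longrightarrow> (\<lambda>i. \<nu> n (A i)) sums \<nu> n (\<Union>i. A i)"
    and addm: "\<And>A. range A \<subseteq> sets M \<Longrightarrow> disjoint_family A \<Longrightarrow> (\<lambda>i. m (A i)) sums m (\<Union>i. A i)"
    and bnd: "\<And>n A. A \<in> sets M \<Longrightarrow> 0 \<le> \<nu> n A \<and> \<nu> n A \<le> c * m A"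
    and null: "\<And>A. A \<in> null_sets M \<Longrightarrow> m A = 0"
    and conv: "\<And>A. A \<in> insert (space M) L \<Longrightarrow> (\<lambda>n. \<nu> n A) \<longlonglongrightarrow> \<kappa> * m A"
    and A: "A \<in> sets M"
  shows "(\<lambda>n. \<nu> n A) \<longlonglongrightarrow> \<kappa> * m A"
proof -
  \<comment> \<open>Null sets are added because \<open>L\<close> generates only modulo null sets,
    and the whole space because complements need the limit of the total mass. The family remains
    stable under intersection.\<close>
  define G where "G = insert (space M) (L \<union> null_sets M)"
  have LM: "L \<subseteq> sets M" and LI: "\<And>A B. A \<in> L \<Longrightarrow> B \<in> L \<Longrightarrow> A \<inter> B \<in> insert {} L"
    and approx: "\<And>B. B \<in> sets M \<Longrightarrow> \<exists>B'\<in>sigma_sets (space M) L. sym_diff B B' \<in> null_sets M"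
    using gen by (auto simp: generating_semiring_mod_null_def)
  have GM: "G \<subseteq> sets M" using LM by (auto simp: G_def)
  then have SM: "sigma_sets (space M) G \<subseteq> sets M" by (rule sets.sigma_sets_subset)
  have Pow: "G \<subseteq> Pow (space M)" using GM sets.space_closed by blast
  have "Int_stable G"
  proof (rule Int_stableI)
    fix a b assume ab: "a \<in> G" "b \<in> G"
    then have M: "a \<in> sets M" "b \<in> sets M" using GM by auto
    then have sp: "space M \<inter> a = a" "space M \<inter> b = b" "a \<inter> space M = a"
      using sets.sets_into_space by auto
    consider "a = space M \<or> b = space M" | "a \<in> null_sets M \<or> b \<in> null_sets M"
      | "a \<in> L" "b \<in> L" using ab by (auto simp: G_def)
    then show "a \<inter> b \<in> G"
    proof cases
      case 1
      then show ?thesis using ab sp by auto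
    next
      case 2
      then have "a \<inter> b \<in> null_sets M" using M null_set_Int1 null_set_Int2 by metis
      then show ?thesis by (simp add: G_def)
    next
      case 3
      then have "a \<inter> b \<in> insert {} L" by (rule LI)
      then show ?thesis by (auto simp: G_def)
    qed
  qed
  interpret S: sigma_algebra "space M" "sigma_sets (space M) G"
    using Pow by (rule sigma_algebra_sigma_sets)
  have "A \<in> sigma_sets (space M) G"
  proof -
    obtain B where B: "B \<in> sigma_sets (space M) L" "sym_diff A B \<in> null_sets M"
      using approx[OF A] by blast
    have "sigma_sets (space M) L \<subseteq> sigma_sets (space M) G"
      by (rule sigma_sets_mono') (auto simp: G_def)
    then have BG: "B \<in> sigma_sets (space M) G" using B by blast
    then have BM: "B \<in> sets M" using SM by blast
    have "A - B \<in> null_sets M" "B - A \<in> null_sets M"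
      using A BM null_sets_subset[OF B(2)] by auto
    then have "A - B \<in> sigma_sets (space M) G" "B - A \<in> sigma_sets (space M) G"
      by (auto simp: G_def)
    \<comment> \<open>\<open>A\<close> arises from \<open>B\<close>, which is generated by
      \<open>L\<close>, by removing one null set and adding another.\<close>
    then have "(B - (B - A)) \<union> (A - B) \<in> sigma_sets (space M) G"
      using BG by blast
    moreover have "(B - (B - A)) \<union> (A - B) = A" by blast
    ultimately show ?thesis by simp
  qed
  with \<open>Int_stable G\<close> Pow show ?thesis
  proof (induction rule: sigma_sets_induct_disjoint)
    case (basic A)
    show ?case
    proof (cases "A \<in> null_sets M")
      case True
      then have "m A = 0" by (rule null)
      moreover have "\<nu> n A = 0" for n
        using bnd[of A n] True \<open>m A = 0\<close> by auto
      ultimately show ?thesis by simp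
    next
      case False
      then show ?thesis using basic conv by (auto simp: G_def)
    qed
  next
    case empty
    have e: "{} \<in> null_sets M" by simp
    then have "\<nu> n {} = 0" for n using bnd[of "{}" n] null[of "{}"] by auto
    then show ?case using null[OF e] by simp
  next
    case (compl A)
    then have AM: "A \<in> sets M" using SM by blast
    have "(\<lambda>n. \<nu> n (space M) - \<nu> n A) \<longlonglongrightarrow> \<kappa> * m (space M) - \<kappa> * m A"
      using compl conv by (intro tendsto_diff) auto
    moreover have "\<nu> n (space M - A) = \<nu> n (space M) - \<nu> n A" for n
      using add AM by (rule countably_additive_Diff)
    moreover have "m (space M - A) = m (space M) - m A"
      using addm AM by (rule countably_additive_Diff)
    ultimately show ?case by (simp add: right_diff_distrib)
  next
    case (union A)
    then have AM: "range A \<subseteq> sets M" using SM by blast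
    show ?case
    proof (rule tendsto_sums_dominated)
      show "(\<lambda>i. \<nu> n (A i)) sums \<nu> n (\<Union>i. A i)" for n
        using AM union(1) by (rule add)
      show "(\<lambda>n. \<nu> n (A i)) \<longlonglongrightarrow> \<kappa> * m (A i)" for i
        by (rule union(3))
      show "(\<lambda>i. \<kappa> * m (A i)) sums (\<kappa> * m (\<Union>i. A i))"
        using addm[OF AM union(1)] by (rule sums_mult)
      show "\<bar>\<nu> n (A i)\<bar> \<le> c * m (A i)" for n i
        using bnd[of "A i" n] AM by auto
      show "summable (\<lambda>i. c * m (A i))"
        using addm[OF AM union(1)] by (intro summable_mult) (rule sums_summable)
    qed
  qed
qed

subsection \<open>Exponential growth\<close>

locale rank_one_exp = rank_one +
  fixes R :: nat
  assumes growth: "grows_exponentially r s C"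
    and cuts_le: "\<And>n. r n \<le> R"
begin

abbreviation p :: "nat \<Rightarrow> nat" where
  "p n \<equiv> card (positions 0 n)"

lemma width_0: "width (C 0) = 1"
  using construction by (simp add: rank_one_construction_def)

lemma p_width: "real (p n) * width (C n) = 1"
  using card_positions[of 0 n] width_0 by simp

lemma p_Suc: "p (Suc n) = r n * p n"
proof -
  have "real (p (Suc n)) * (width (C n) / r n) = 1"
    using p_width[of "Suc n"] unfolding width_Suc .
  then have "real (p (Suc n)) * width (C n) = real (r n)"
    using cuts[of n] by (simp add: divide_simps split: if_splits)
  also have "\<dots> = real (r n * p n) * width (C n)"
    using p_width[of n] by simp
  finally have "real (p (Suc n)) = real (r n * p n)"
    using width_pos[of n] by (metis less_irrefl mult_right_cancel)
  then show ?thesis by linarith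
qed

text \<open>Every cut at least doubles the count. This crude bound makes both \<open>p\<close> and
  the heights unbounded.\<close>

lemma less_p: "n < p n"
proof (induction n)
  case 0
  show ?case using p_width[of 0] by (cases "p 0") auto
next
  case (Suc n)
  have "2 * p n \<le> p (Suc n)" using cuts[of n] by (simp add: p_Suc)
  then show ?case using Suc by simp
qed

lemma less_height: "n < height (C n)"
proof -
  have "p n \<le> card {..<height (C n)}"
    by (rule card_mono) (auto simp: positions_def)
  then show ?thesis using less_p[of n] by simp
qed

text \<open>This is where exponential growth enters: a base level of \<open>C (Suc m)\<close> lies
  in a copy of \<open>C m\<close>, and the last spacers, at least half of all levels, are above
  every copy.\<close>

lemma positions_lower_half:
  assumes "q \<in> positions 0 n"
  shows "2 * q < height (C n)"
proof (cases n)
  case 0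
  then show ?thesis using assms positions_level(1)[of q 0] height_0 by simp
next
  case (Suc m)
  obtain Q where Q: "copies (C m) (C (Suc m)) Q"
    "\<And>q. q \<in> Q \<Longrightarrow> q + height (C m) + s m (r m - 1) \<le> height (C (Suc m))"
    using copies_Suc by metis
  have "q \<in> (\<lambda>(q', q). q' + q) ` (Q \<times> positions 0 m)"
    using positionsI[OF copies_trans[OF copies Q(1)], of 0] assms Suc by simp
  then obtain q1 q2 where q: "q = q1 + q2" "q1 \<in> Q" "q2 \<in> positions 0 m" by auto
  have "q2 < height (C m)" using positions_level(1) q(3) by blast
  moreover have "height (C (Suc m)) \<le> 2 * s m (r m - 1)"
    using growth by (simp add: grows_exponentially_def)
  ultimately show ?thesis using Q(2)[OF q(2)] q(1) Suc by simp
qed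

text \<open>The first column whose height guarantees that \<open>k\<close> steps from a base level
  fit. The \<open>+ 1\<close> is admissible because a base position satisfies
  \<open>2 * i + 1 \<le> height (C n)\<close>, so that \<open>i + k \<le> height (C n)\<close> still
  follows.\<close>

definition stage :: "nat \<Rightarrow> nat" where
  "stage k = (LEAST n. 2 * k \<le> height (C n) + 1)"

lemma le_stage: "2 * k \<le> height (C (stage k)) + 1"
proof -
  have "2 * k \<le> height (C (2 * k)) + 1" using less_height[of "2 * k"] by simp
  then show ?thesis unfolding stage_def by (rule LeastI)
qed

lemma less_stage: "n < stage k \<Longrightarrow> height (C n) + 1 < 2 * k"
proof -
  assume "n < stage k"
  then have "\<not> 2 * k \<le> height (C n) + 1" unfolding stage_def by (rule not_less_Least)
  then show ?thesis by simp
qed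

lemma eventually_stage: "eventually (\<lambda>k. n \<le> stage k) sequentially"
proof (rule eventually_sequentiallyI)
  \<comment> \<open>The sum serves as a common upper bound for the finitely many heights before
    stage \<open>n\<close>.\<close>
  fix k assume k: "(\<Sum>m<n. height (C m) + 1) \<le> k"
  show "n \<le> stage k"
  proof (rule ccontr)
    assume "\<not> n \<le> stage k"
    then have "height (C (stage k)) + 1 \<le> (\<Sum>m<n. height (C m) + 1)"
      by (intro member_le_sum) auto
    then show False using le_stage[of k] k by linarith
  qed
qed

lemma corr_stage:
  assumes "A \<in> sets borel" "B \<in> sets borel" "A \<subseteq> base" "B \<subseteq> base" "2 * k \<le> height (C n) + 1"
  shows "(\<Sum>m<k. measure lborel (A \<inter> (rank_one_map C ^^ m) ` B)) = corr n k A B"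
proof -
  have "i + k \<le> height (C n)" if "i \<in> positions 0 n" for i
    using positions_lower_half[OF that] assms(5) by linarith
  then show ?thesis
    using assms(1-4) by (intro sum_measure_Int_funpow)
qed

section \<open>Growth of the return sequence\<close>

text \<open>The return sequence of \<open>F = base\<close>, because \<open>\<mu>(F) = 1\<close>.\<close>

definition a :: "nat \<Rightarrow> real" where
  "a k = (\<Sum>m<k. measure lborel (base \<inter> (rank_one_map C ^^ m) ` base))"

lemma a_corr: "2 * k \<le> height (C n) + 1 \<Longrightarrow> a k = corr n k base base"
  unfolding a_def by (rule corr_stage) auto

lemma a_mono: "k \<le> l \<Longrightarrow> a k \<le> a l"
  unfolding a_def by (rule sum_mono2) auto

text \<open>Base positions lie below \<open>k\<close>, so every pair \<open>i \<le> j\<close> is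
  counted. By symmetry these are at least half of all \<open>p n * p n\<close> pairs, each of weight
  \<open>1 / p n\<close>.\<close>

lemma half_p_le_corr:
  assumes "height (C n) \<le> 2 * k"
  shows "real (p n) / 2 \<le> corr n k base base"
proof -
  let ?P = "positions 0 n" and ?w = "width (C n)"
  let ?S = "\<Sum>i\<in>?P. \<Sum>j\<in>?P. if i \<le> j then ?w else 0"
  have S: "corr n k base base = ?S"
    unfolding corr_def
  proof (intro sum.cong refl)
    fix i j assume ij: "i \<in> ?P" "j \<in> ?P"
    then have "j < k" using positions_lower_half[OF ij(2)] assms by linarith
    then show "(if i \<le> j \<and> j < i + k then cross (C n) i j base base else 0)
      = (if i \<le> j then ?w else 0)"
      using cross_levels[OF width_pos] positions_level(2) ij by simp
  qed
  have "?S = (\<Sum>i\<in>?P. \<Sum>j\<in>?P. if j \<le> i then ?w else 0)"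
    by (rule sum.swap)
  then have "2 * ?S = (\<Sum>i\<in>?P. \<Sum>j\<in>?P. (if i \<le> j then ?w else 0) + (if j \<le> i then ?w else 0))"
    by (simp add: sum.distrib)
  also have "\<dots> \<ge> (\<Sum>i\<in>?P. \<Sum>j\<in>?P. ?w)"
    using width_pos[of n] by (intro sum_mono) auto
  finally have "(\<Sum>i\<in>?P. \<Sum>j\<in>?P. ?w) \<le> 2 * ?S" .
  then have "p n * (p n * ?w) \<le> 2 * ?S" by simp
  then show ?thesis using p_width[of n] S by simp
qed

text \<open>The column before \<open>stage k\<close> is too short for \<open>k\<close>, so its lower
  bound on the return sequence applies, and one more cutting multiplies \<open>p\<close> by at most
  \<open>R\<close>. If \<open>stage k\<close> is 0, the term at time 0 suffices.\<close>

lemma p_stage_le: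
  assumes "k > 0"
  shows "real (p (stage k)) \<le> 2 * R * a k"
proof (cases "stage k")
  case 0
  have "R \<ge> 2" using cuts[of 0] cuts_le[of 0] by linarith
  moreover have "a 1 = 1" by (simp add: a_def base_eq)
  then have "a k \<ge> 1" using a_mono[of 1 k] assms by simp
  ultimately have "1 * 1 \<le> (2 * R) * a k" by (intro mult_mono) auto
  then show ?thesis using p_width[of 0] width_0 0 by simp
next
  case (Suc m)
  \<comment> \<open>The only integer with
    \<open>height (C m) \<le> 2 * ?l \<le> height (C m) + 1\<close>: the left inequality gives the
    lower bound on \<open>corr\<close>, the right one identifies \<open>corr\<close> with
    \<open>a ?l\<close>.\<close>
  let ?l = "(height (C m) + 1) div 2"
  have "?l \<le> k" using less_stage[of m k] Suc by simp
  have "real (p m) / 2 \<le> corr m ?l base base"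
    by (rule half_p_le_corr) simp
  also have "\<dots> = a ?l" by (rule a_corr[symmetric]) simp
  also have "\<dots> \<le> a k" using \<open>?l \<le> k\<close> by (rule a_mono)
  finally have *: "real (p m) \<le> 2 * a k" by simp
  have "real (p (stage k)) = real (r m) * real (p m)" by (simp add: Suc p_Suc)
  also have "\<dots> \<le> real R * (2 * a k)"
    using cuts_le[of m] * by (intro mult_mono) auto
  finally show ?thesis by (simp add: mult_ac)
qed

lemma R_pos: "R > 0"
  using cuts[of 0] cuts_le[of 0] by linarith

lemma a_pos: "k > 0 \<Longrightarrow> a k > 0"
proof -
  assume "k > 0"
  then have "real (p (stage k)) \<le> 2 * R * a k" by (rule p_stage_le)
  moreover have "real (p (stage k)) > 0" using less_p[of "stage k"] by linarith
  ultimately have "0 < 2 * R * a k" by linarith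
  then show ?thesis using R_pos by (simp add: zero_less_mult_iff)
qed

lemma a_at_top: "filterlim a at_top sequentially"
proof (rule filterlim_at_top[THEN iffD2], rule allI)
  fix Z :: real
  obtain n :: nat where n: "real n \<ge> 2 * R * Z" using real_arch_simple by blast
  show "\<forall>\<^sub>F k in sequentially. Z \<le> a k"
    using eventually_stage[of n] eventually_gt_at_top[of 0]
  proof eventually_elim
    case (elim k)
    have "2 * R * Z \<le> real (p (stage k))" using n less_p[of "stage k"] elim by linarith
    also have "\<dots> \<le> 2 * R * a k" using p_stage_le elim by simp
    finally show ?case using R_pos by simp
  qed
qed

text \<open>For subsets of the base this is the quotient in the definition of weak rational
  ergodicity. With \<open>corr\<close> in place of the true correlations, additivity and bounds hold
  for all Borel sets.\<close>

definition \<phi> :: "nat \<Rightarrow> real set \<Rightarrow> real set \<Rightarrow> real" where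
  "\<phi> k A B = corr (stage k) k A B / a k"

lemma a_nonneg: "a k \<ge> 0"
  by (simp add: a_def sum_nonneg)

lemma \<phi>_nonneg: "0 \<le> \<phi> k A B"
  by (simp add: \<phi>_def corr_nonneg a_nonneg)

lemma corr_ratio_le:
  fixes x :: real
  assumes "corr (stage k) k A B \<le> p (stage k) * x" "0 \<le> x"
  shows "\<phi> k A B \<le> 2 * R * x"
proof (cases "k = 0")
  \<comment> \<open>Both the numerator and \<open>a 0\<close> belong to an empty range of times; the
    quotient by 0 is 0.\<close>
  case True
  then show ?thesis using assms by (simp add: \<phi>_def a_def)
next
  case False
  note assms(1)
  also have "p (stage k) * x \<le> (2 * R * a k) * x"
    using p_stage_le False assms by (intro mult_right_mono) auto
  finally show ?thesis
    using a_pos[of k] False by (simp add: \<phi>_def divide_le_eq mult_ac)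
qed

text \<open>One bound for each argument, uniform in \<open>k\<close>: the domination for extending
  convergence in either variable.\<close>

lemma \<phi>_le:
  assumes "A \<in> sets borel" "B \<in> sets borel"
  shows "\<phi> k A B \<le> 2 * R * measure lborel (A \<inter> base)" "\<phi> k A B \<le> 2 * R * measure lborel (B \<inter> base)"
  using corr_ratio_le[OF corr_le1[OF assms] measure_nonneg]
    corr_ratio_le[OF corr_le2[OF assms] measure_nonneg] by simp_all

end

subsection \<open>Levels\<close>

context rank_one
begin

text \<open>Extends \<open>positions\<close> from bottom levels to arbitrary sets. It is applied to
  levels of an earlier column, which all other levels of \<open>C n\<close> miss.\<close>

definition below :: "nat \<Rightarrow> real set \<Rightarrow> nat set" where
  "below n A = {j. j < height (C n) \<and> level (C n) j \<subseteq> A}"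

lemma finite_below [simp]: "finite (below n A)"
  by (simp add: below_def)

lemma below_base: "below n base = positions 0 n"
  by (simp add: below_def positions_def)

lemma below_level:
  assumes "m \<le> n" "i < height (C m)"
  shows "below n (level (C m) i) = (\<lambda>q. q + i) ` positions m n"
proof (intro equalityI subsetI)
  fix j assume "j \<in> below n (level (C m) i)"
  then have j: "j < height (C n)" "level (C n) j \<inter> level (C m) i \<noteq> {}"
    using level_nonempty[OF width_pos] by (auto simp: below_def)
  obtain q where "q \<in> positions m n" "j = q + i"
    using copies_position[OF copies[OF assms(1)] column assms(2) j] .
  then show "j \<in> (\<lambda>q. q + i) ` positions m n" by blast
next
  fix j assume "j \<in> (\<lambda>q. q + i) ` positions m n"
  then show "j \<in> below n (level (C m) i)"
    using copiesD(1,2)[OF copies[OF assms(1)] _ assms(2)] by (auto simp: below_def)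
qed

lemma card_below_level:
  assumes "m \<le> n" "i < height (C m)"
  shows "real (card (below n (level (C m) i))) * width (C n) = width (C m)"
proof -
  have "card ((\<lambda>q. q + i) ` positions m n) = card (positions m n)"
    by (intro card_image) (simp add: inj_on_def)
  then show ?thesis using assms by (simp add: below_level card_positions)
qed

lemma level_disjoint_level:
  assumes "m \<le> n" "i < height (C m)" "j < height (C n)" "j \<notin> below n (level (C m) i)"
  shows "level (C n) j \<inter> level (C m) i = {}"
proof (rule ccontr)
  assume "level (C n) j \<inter> level (C m) i \<noteq> {}"
  then obtain q where "q \<in> positions m n" "j = q + i"
    using copies_position[OF copies[OF assms(1)] column assms(2,3)] by metis
  then show False using assms(4) below_level[OF assms(1,2)] by blast
qed

lemma below_trans:
  assumes "m \<le> n" "n \<le> N" "i < height (C m)"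
  shows "below N (level (C m) i) = (\<lambda>(q, d). q + d) ` (positions n N \<times> below n (level (C m) i))"
proof -
  have "positions m N = (\<lambda>(q', q). q' + q) ` (positions n N \<times> positions m n)"
    by (rule positionsI[OF copies_trans[OF copies[OF assms(1)] copies[OF assms(2)]]])
  moreover have "below N (level (C m) i) = (\<lambda>q. q + i) ` positions m N"
    using assms by (intro below_level) auto
  ultimately have "x \<in> below N (level (C m) i) \<longleftrightarrow>
      (\<exists>q'\<in>positions n N. \<exists>q\<in>positions m n. x = q' + (q + i))" for x
    by (fastforce simp: add.assoc)
  then show ?thesis
    unfolding below_level[OF assms(1,3)] by (auto simp: image_iff)
qed

text \<open>Each level of \<open>C N\<close> inside the given one has a unique height
  \<open>d\<close> in a unique copy of \<open>C n\<close>, which starts at \<open>q\<close>.\<close>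

lemma sum_below:
  fixes f :: "nat \<Rightarrow> real"
  assumes "m \<le> n" "n \<le> N" "i < height (C m)"
  shows "(\<Sum>j\<in>below N (level (C m) i). f j)
    = (\<Sum>q\<in>positions n N. \<Sum>d\<in>below n (level (C m) i). f (q + d))"
proof -
  have "inj_on (\<lambda>(q, d). q + d) (positions n N \<times> below n (level (C m) i))"
    using copies_inj[OF copies[OF assms(2)] column width_pos]
    by (rule inj_on_subset) (auto simp: below_def)
  then have "(\<Sum>j\<in>below N (level (C m) i). f j)
    = (\<Sum>(q, d)\<in>positions n N \<times> below n (level (C m) i). f (q + d))"
    unfolding below_trans[OF assms] by (subst sum.reindex) (auto simp: case_prod_unfold)
  then show ?thesis by (simp add: sum.cartesian_product)
qed

text \<open>A level of \<open>C N\<close> lies inside \<open>A\<close> or misses it, and likewise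
  for \<open>B\<close>, so \<open>cross\<close> takes only the values \<open>width (C N)\<close> and
  0.\<close>

lemma corr_below:
  assumes A: "A = level (C m) i" "m \<le> N" "i < height (C m)" "A \<subseteq> base"
    and B: "B = level (C m') i'" "m' \<le> N" "i' < height (C m')" "B \<subseteq> base"
  shows "corr N k A B = (\<Sum>i\<in>below N B. \<Sum>j\<in>below N A.
    if i \<le> j \<and> j < i + k then width (C N) else 0)"
proof -
  let ?P = "positions 0 N"
  let ?f = "\<lambda>i j. if i \<le> j \<and> j < i + k then cross (C N) i j A B else 0"
  have sub: "below N A \<subseteq> ?P" "below N B \<subseteq> ?P"
    using A(4) B(4) unfolding below_base[symmetric] by (auto simp: below_def)
  have z: "?f i j = 0" if "i \<in> ?P" "j \<in> ?P" "i \<notin> below N B \<or> j \<notin> below N A" for i j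
    using that level_disjoint_level[OF A(2,3), of j] level_disjoint_level[OF B(2,3), of i]
      positions_level(1) cross_disjoint[of "C N" j A i B] unfolding A(1) B(1) by auto
  have "corr N k A B = (\<Sum>i\<in>?P. \<Sum>j\<in>?P. ?f i j)" by (simp add: corr_def)
  also have "\<dots> = (\<Sum>i\<in>below N B. \<Sum>j\<in>?P. ?f i j)"
  proof (rule sum.mono_neutral_right[OF _ sub(2)])
    show "\<forall>i\<in>?P - below N B. (\<Sum>j\<in>?P. ?f i j) = 0"
    proof (intro ballI sum.neutral)
      fix i j assume "i \<in> ?P - below N B" "j \<in> ?P"
      then show "?f i j = 0" by (intro z) auto
    qed
  qed simp
  also have "\<dots> = (\<Sum>i\<in>below N B. \<Sum>j\<in>below N A. ?f i j)"
  proof (rule sum.cong[OF refl])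
    fix i assume "i \<in> below N B"
    then have "i \<in> ?P" using sub(2) by (rule subsetD[rotated])
    then have "?f i j = 0" if "j \<in> ?P - below N A" for j
      using that by (intro z) auto
    then show "(\<Sum>j\<in>?P. ?f i j) = (\<Sum>j\<in>below N A. ?f i j)"
      by (intro sum.mono_neutral_right[OF finite_positions sub(1)] ballI)
  qed
  also have "\<dots> = (\<Sum>i\<in>below N B. \<Sum>j\<in>below N A. if i \<le> j \<and> j < i + k then width (C N) else 0)"
    using cross_levels[OF width_pos] by (intro sum.cong refl) (simp add: below_def)
  finally show ?thesis .
qed

text \<open>
  The correlation of two levels of \<open>C M\<close>, computed inside \<open>C N\<close>; it depends only on the
  difference \<open>z\<close> of their heights.
\<close>

definition window :: "nat \<Rightarrow> nat \<Rightarrow> nat \<Rightarrow> int \<Rightarrow> real" where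
  "window M N k z = (\<Sum>q\<in>positions M N. \<Sum>q'\<in>positions M N.
     if 0 \<le> int q' - int q + z \<and> int q' - int q + z < int k then width (C N) else 0)"

text \<open>Shifting by \<open>z\<close> matters only if \<open>q' - q\<close> is within
  \<open>\<bar>z\<bar>\<close> of 0 or \<open>k\<close>. For fixed \<open>q\<close> there are at
  most \<open>4 * \<bar>z\<bar>\<close> such \<open>q'\<close>, and the sum over \<open>q\<close>
  turns \<open>width (C N)\<close> into \<open>width (C M)\<close>. The bound depends on neither
  \<open>N\<close> nor \<open>k\<close>.\<close>

lemma window_diff:
  assumes "M \<le> N"
  shows "\<bar>window M N k z - window M N k 0\<bar> \<le> 4 * \<bar>real_of_int z\<bar> * width (C M)"
proof -
  let ?Q = "positions M N" and ?w = "width (C N)"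
  let ?g = "\<lambda>z q q'. if 0 \<le> int q' - int q + z \<and> int q' - int q + z < int k then ?w else 0"
  have inner: "\<bar>\<Sum>q'\<in>?Q. ?g z q q' - ?g 0 q q'\<bar> \<le> 4 * \<bar>real_of_int z\<bar> * ?w" for q
  proof -
    let ?J = "{- \<bar>z\<bar>..<\<bar>z\<bar>} \<union> {int k - \<bar>z\<bar>..<int k + \<bar>z\<bar>}"
    define D where "D = {q' \<in> ?Q. int q' - int q \<in> ?J}"
    have "card D \<le> card ?J"
      by (rule card_inj_on_le[of "\<lambda>q'. int q' - int q"]) (auto simp: D_def inj_on_def)
    also have "\<dots> \<le> card {- \<bar>z\<bar>..<\<bar>z\<bar>} + card {int k - \<bar>z\<bar>..<int k + \<bar>z\<bar>}"
      by (rule card_Un_le)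
    also have "\<dots> = nat (4 * \<bar>z\<bar>)" by simp
    finally have "real (card D) \<le> real (nat (4 * \<bar>z\<bar>))" by simp
    then have D: "real (card D) \<le> 4 * \<bar>real_of_int z\<bar>" by simp
    have J: "\<bar>?g z q q' - ?g 0 q q'\<bar> \<le> (if int q' - int q \<in> ?J then ?w else 0)" for q'
    proof (cases "int q' - int q \<in> ?J")
      case True
      then show ?thesis using width_pos[of N] by simp
    next
      case False
      then have "0 \<le> int q' - int q + z \<and> int q' - int q + z < int k \<longleftrightarrow>
          0 \<le> int q' - int q + 0 \<and> int q' - int q + 0 < int k"
        by (simp only: Un_iff atLeastLessThan_iff) arith
      then show ?thesis using width_pos[of N] by simp
    qed
    have "\<bar>\<Sum>q'\<in>?Q. ?g z q q' - ?g 0 q q'\<bar> \<le> (\<Sum>q'\<in>?Q. \<bar>?g z q q' - ?g 0 q q'\<bar>)"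
      by (rule sum_abs)
    also have "\<dots> \<le> (\<Sum>q'\<in>?Q. if int q' - int q \<in> ?J then ?w else 0)"
      by (intro sum_mono J)
    also have "\<dots> = (\<Sum>q'\<in>D. ?w)"
      unfolding D_def by (rule sum.inter_filter[symmetric]) simp
    also have "\<dots> \<le> 4 * \<bar>real_of_int z\<bar> * ?w"
      using D width_pos[of N] by simp
    finally show ?thesis .
  qed
  have "window M N k z - window M N k 0 = (\<Sum>q\<in>?Q. \<Sum>q'\<in>?Q. ?g z q q' - ?g 0 q q')"
    unfolding window_def by (simp only: sum_subtractf)
  then have "\<bar>window M N k z - window M N k 0\<bar> \<le> (\<Sum>q\<in>?Q. \<bar>\<Sum>q'\<in>?Q. ?g z q q' - ?g 0 q q'\<bar>)"
    by (simp only: sum_abs)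
  also have "\<dots> \<le> (\<Sum>q\<in>?Q. 4 * \<bar>real_of_int z\<bar> * ?w)"
    by (intro sum_mono inner)
  also have "\<dots> = 4 * \<bar>real_of_int z\<bar> * (card ?Q * ?w)" by simp
  also have "\<dots> = 4 * \<bar>real_of_int z\<bar> * width (C M)"
    using card_positions[OF assms] by simp
  finally show ?thesis .
qed

text \<open>Heights in \<open>C N\<close> split as \<open>q + e\<close> and \<open>q' + d\<close>,
  by copy of \<open>C M\<close> and height within it; the time condition then involves only
  \<open>q' - q\<close> and \<open>d - e\<close>.\<close>

lemma corr_window:
  assumes A: "A = level (C m) i" "m \<le> M" "i < height (C m)" "A \<subseteq> base"
    and B: "B = level (C m') i'" "m' \<le> M" "i' < height (C m')" "B \<subseteq> base"
    and N: "M \<le> N"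
  shows "corr N k A B = (\<Sum>e\<in>below M B. \<Sum>d\<in>below M A. window M N k (int d - int e))"
proof -
  let ?Q = "positions M N" and ?A = "below M A" and ?B = "below M B"
  define f :: "nat \<Rightarrow> nat \<Rightarrow> real"
    where "f i j = (if i \<le> j \<and> j < i + k then width (C N) else 0)" for i j
  have mN: "m \<le> N" "m' \<le> N" using assms by auto
  have f: "f (q + e) (q' + d) = (if 0 \<le> int q' - int q + (int d - int e) \<and>
      int q' - int q + (int d - int e) < int k then width (C N) else 0)" for q e q' d
    unfolding f_def by (intro if_cong) (auto simp: algebra_simps)
  have sA: "(\<Sum>j\<in>below N A. g j) = (\<Sum>q\<in>?Q. \<Sum>d\<in>?A. g (q + d))" for g :: "nat \<Rightarrow> real"
    unfolding A(1) using A N by (intro sum_below)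
  have sB: "(\<Sum>j\<in>below N B. g j) = (\<Sum>q\<in>?Q. \<Sum>d\<in>?B. g (q + d))" for g :: "nat \<Rightarrow> real"
    unfolding B(1) using B N by (intro sum_below)
  have "corr N k A B = (\<Sum>i\<in>below N B. \<Sum>j\<in>below N A. f i j)"
    unfolding f_def by (rule corr_below[OF A(1) mN(1) A(3,4) B(1) mN(2) B(3,4)])
  also have "\<dots> = (\<Sum>q\<in>?Q. \<Sum>e\<in>?B. \<Sum>q'\<in>?Q. \<Sum>d\<in>?A. f (q + e) (q' + d))"
    unfolding sA sB ..
  also have "\<dots> = (\<Sum>e\<in>?B. \<Sum>q\<in>?Q. \<Sum>q'\<in>?Q. \<Sum>d\<in>?A. f (q + e) (q' + d))"
    by (rule sum.swap)
  also have "\<dots> = (\<Sum>e\<in>?B. \<Sum>q\<in>?Q. \<Sum>d\<in>?A. \<Sum>q'\<in>?Q. f (q + e) (q' + d))"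
    by (intro sum.cong refl sum.swap)
  also have "\<dots> = (\<Sum>e\<in>?B. \<Sum>d\<in>?A. \<Sum>q\<in>?Q. \<Sum>q'\<in>?Q. f (q + e) (q' + d))"
    by (intro sum.cong refl sum.swap)
  also have "\<dots> = (\<Sum>e\<in>?B. \<Sum>d\<in>?A. window M N k (int d - int e))"
    by (simp only: window_def f)
  finally show ?thesis .
qed

text \<open>Heights within \<open>C M\<close> differ by less than \<open>height (C M)\<close>, so
  every window agrees with the one at 0 up to a bounded error. To leading order the levels enter
  only through the number \<open>c\<close> of pairs.\<close>

lemma corr_approx:
  assumes A: "A = level (C m) i" "m \<le> M" "i < height (C m)" "A \<subseteq> base"
    and B: "B = level (C m') i'" "m' \<le> M" "i' < height (C m')" "B \<subseteq> base"
    and N: "M \<le> N"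
  defines "c \<equiv> real (card (below M A)) * real (card (below M B))"
  shows "\<bar>corr N k A B - c * window M N k 0\<bar> \<le> c * (4 * height (C M) * width (C M))"
proof -
  let ?A = "below M A" and ?B = "below M B" and ?u = "window M N k 0"
  let ?W = "\<lambda>e d. window M N k (int d - int e)"
  have W: "\<bar>?W e d - ?u\<bar> \<le> 4 * height (C M) * width (C M)" if "e \<in> ?B" "d \<in> ?A" for e d
  proof -
    have "d < height (C M)" "e < height (C M)" using that by (auto simp: below_def)
    then have "\<bar>real_of_int (int d - int e)\<bar> \<le> height (C M)" by simp
    then have "4 * \<bar>real_of_int (int d - int e)\<bar> * width (C M) \<le> 4 * height (C M) * width (C M)"
      using width_pos[of M] by (intro mult_right_mono) auto
    then show ?thesis using window_diff[OF N, of k "int d - int e"] by linarith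
  qed
  have "corr N k A B - c * ?u = (\<Sum>e\<in>?B. \<Sum>d\<in>?A. ?W e d - ?u)"
    unfolding corr_window[OF A B N] by (simp add: sum_subtractf c_def)
  then have "\<bar>corr N k A B - c * ?u\<bar> \<le> (\<Sum>e\<in>?B. \<bar>\<Sum>d\<in>?A. ?W e d - ?u\<bar>)"
    by (simp only: sum_abs)
  also have "\<dots> \<le> (\<Sum>e\<in>?B. \<Sum>d\<in>?A. \<bar>?W e d - ?u\<bar>)"
    by (intro sum_mono sum_abs)
  also have "\<dots> \<le> (\<Sum>e\<in>?B. \<Sum>d\<in>?A. 4 * height (C M) * width (C M))"
    by (intro sum_mono W)
  finally show ?thesis by (simp add: c_def mult_ac)
qed

end

section \<open>Limits for pairs of levels\<close>

context rank_one_exp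
begin

text \<open>In a common column \<open>C M\<close>, both the correlation and \<open>a k\<close> are
  compared with the same \<open>u\<close>. The factors are \<open>c\<close> and the square of
  \<open>p M\<close>, with ratio \<open>\<alpha>\<close>; hence the correlation minus
  \<open>\<alpha> * a k\<close> stays bounded while \<open>a k\<close> tends to infinity.\<close>

lemma \<phi>_level_tendsto:
  assumes "A \<in> levels C" "B \<in> levels C" "A \<subseteq> base" "B \<subseteq> base"
  shows "(\<lambda>k. \<phi> k A B) \<longlonglongrightarrow> measure lborel A * measure lborel B"
proof -
  obtain m i where A: "A = level (C m) i" "i < height (C m)"
    using assms(1) by (auto simp: levels_def)
  obtain m' i' where B: "B = level (C m') i'" "i' < height (C m')"
    using assms(2) by (auto simp: levels_def)
  define M where "M = max m m'"
  have M: "m \<le> M" "m' \<le> M" by (simp_all add: M_def)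
  define \<alpha> where "\<alpha> = measure lborel A * measure lborel B"
  define c where "c = real (card (below M A)) * real (card (below M B))"
  define K where "K = 4 * height (C M) * width (C M)"
  let ?p = "real (p M)"
  have p0: "?p > 0" using less_p[of M] by linarith
  have "measure lborel A = card (below M A) * width (C M)"
    "measure lborel B = card (below M B) * width (C M)"
    using card_below_level[OF M(1) A(2)] card_below_level[OF M(2) B(2)]
    by (simp_all add: A B measure_level width_pos)
  moreover have "width (C M) = 1 / ?p"
    using p_width[of M] p0 by (metis less_irrefl nonzero_mult_div_cancel_left)
  ultimately have \<alpha>: "\<alpha> = c / (?p * ?p)"
    by (simp add: \<alpha>_def c_def)
  have "?p * ?p \<noteq> 0" using mult_pos_pos[OF p0 p0] by linarith
  from nonzero_eq_divide_eq[OF this, THEN iffD1, OF \<alpha>]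
  have c: "c = \<alpha> * (?p * ?p)" by (rule sym)
  have \<alpha>0: "\<bar>\<alpha>\<bar> = \<alpha>" by (simp add: \<alpha>_def)
  have ev: "\<forall>\<^sub>F k in sequentially. norm (\<phi> k A B - \<alpha>) \<le> 2 * c * K / a k"
    using eventually_stage[of M] eventually_gt_at_top[of 0]
  proof eventually_elim
    case (elim k)
    define u where "u = window M (stage k) k 0"
    have ap: "a k > 0" using elim by (intro a_pos)
    have 1: "\<bar>corr (stage k) k A B - c * u\<bar> \<le> c * K"
      unfolding c_def K_def u_def
      by (rule corr_approx[OF A(1) M(1) A(2) assms(3) B(1) M(2) B(2) assms(4) elim(1)])
    \<comment> \<open>The base is level 0 of \<open>C 0\<close> and splits into \<open>p M\<close>
      levels of \<open>C M\<close>, so its factor is the square of \<open>p M\<close>.\<close>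
    have "\<bar>corr (stage k) k base base - (?p * ?p) * u\<bar> \<le> (?p * ?p) * K"
      using corr_approx[OF refl _ height_pos _ refl _ height_pos _ elim(1), of 0 0 k]
      by (simp add: below_base u_def K_def)
    then have "\<bar>a k - (?p * ?p) * u\<bar> \<le> (?p * ?p) * K"
      using a_corr[OF le_stage] by simp
    then have "\<bar>\<alpha>\<bar> * \<bar>a k - (?p * ?p) * u\<bar> \<le> \<bar>\<alpha>\<bar> * ((?p * ?p) * K)"
      by (intro mult_left_mono) auto
    moreover have "\<alpha> * a k - c * u = \<alpha> * (a k - (?p * ?p) * u)"
      unfolding c by (simp add: algebra_simps)
    moreover have "\<bar>\<alpha>\<bar> * ((?p * ?p) * K) = c * K"
      unfolding c \<alpha>0 by (rule mult.assoc[symmetric])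
    ultimately have 2: "\<bar>\<alpha> * a k - c * u\<bar> \<le> c * K"
      using abs_mult[of \<alpha> "a k - (?p * ?p) * u"] by argo
    have "\<phi> k A B - \<alpha> = (corr (stage k) k A B - \<alpha> * a k) / a k"
      using ap by (simp add: \<phi>_def field_simps)
    also have "norm \<dots> = \<bar>corr (stage k) k A B - \<alpha> * a k\<bar> / a k"
      using ap by simp
    also have "\<dots> \<le> 2 * c * K / a k"
      using 1 2 ap by (intro divide_right_mono) auto
    finally show ?case .
  qed
  have "(\<lambda>k. 2 * c * K / a k) \<longlonglongrightarrow> 0"
    by (intro tendsto_divide_0[OF tendsto_const] filterlim_at_top_imp_at_infinity a_at_top)
  then have "(\<lambda>k. \<phi> k A B - \<alpha>) \<longlonglongrightarrow> 0"
    using ev by (rule Lim_null_comparison[rotated])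
  then show ?thesis unfolding \<alpha>_def by (rule LIM_zero_cancel)
qed

section \<open>From levels to all measurable sets\<close>

lemma \<phi>_Int_base: "\<phi> k (A \<inter> base) (B \<inter> base) = \<phi> k A B"
  by (simp add: \<phi>_def corr_Int_base)

lemma open_space: "open (\<Union>(levels C))"
  by (auto simp: levels_def)

lemma space_eq: "space (rank_one_space C) = \<Union>(levels C)"
  using open_space by (simp add: rank_one_space_def)

lemma sets_iff: "A \<in> sets (rank_one_space C) \<longleftrightarrow> A \<subseteq> \<Union>(levels C) \<and> A \<in> sets borel"
  using open_space by (simp add: rank_one_space_def sets_restrict_space_iff)

lemma measure_eq: "A \<subseteq> \<Union>(levels C) \<Longrightarrow> measure (rank_one_space C) A = measure lborel A"
  using open_space by (simp add: rank_one_space_def measure_restrict_space)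

lemma emeasure_eq: "A \<subseteq> \<Union>(levels C) \<Longrightarrow> emeasure (rank_one_space C) A = emeasure lborel A"
  using open_space by (simp add: rank_one_space_def emeasure_restrict_space)

lemma generating: "generating_semiring_mod_null (rank_one_space C) (levels C)"
  using construction by (simp add: rank_one_construction_def)

lemma base_level: "base \<in> levels C"
  using height_pos[of 0] by (auto simp: levels_def)

lemma base_subset: "base \<subseteq> \<Union>(levels C)"
  using base_level by blast

text \<open>Only traces on the base matter to \<open>\<phi>\<close>, and the trace of a generator is
  empty or again a level, by the semiring property.\<close>

lemma \<phi>_generator_tendsto:
  assumes "A \<in> insert (space (rank_one_space C)) (levels C)"
    and "B \<in> insert (space (rank_one_space C)) (levels C)"
  shows "(\<lambda>k. \<phi> k A B) \<longlonglongrightarrow> measure lborel (A \<inter> base) * measure lborel (B \<inter> base)"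
proof -
  have inter: "X \<inter> base \<in> insert {} (levels C)"
    if "X \<in> insert (space (rank_one_space C)) (levels C)" for X
  proof (cases "X \<in> levels C")
    case True
    then show ?thesis
      using generating base_level by (auto simp: generating_semiring_mod_null_def)
  next
    case False
    then have "X \<inter> base = base" using that base_subset by (auto simp: space_eq)
    then show ?thesis using base_level by simp
  qed
  have "corr n k A B = 0" if "A \<inter> base = {} \<or> B \<inter> base = {}" for n k
  proof -
    have "corr n k (A \<inter> base) (B \<inter> base) = 0"
      unfolding corr_def using that by (intro sum.neutral ballI) (auto simp: cross_disjoint)
    then show ?thesis by (simp add: corr_Int_base)
  qed
  then have 0: "\<phi> k A B = 0" if "A \<inter> base = {} \<or> B \<inter> base = {}" for k
    using that by (simp add: \<phi>_def)
  show ?thesis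
  proof (cases "A \<inter> base = {} \<or> B \<inter> base = {}")
    case True
    then have "measure lborel (A \<inter> base) * measure lborel (B \<inter> base) = 0" by auto
    then show ?thesis by (simp only: 0[OF True] tendsto_const)
  next
    case False
    then have "A \<inter> base \<in> levels C" "B \<inter> base \<in> levels C"
      using inter[OF assms(1)] inter[OF assms(2)] by auto
    then have "(\<lambda>k. \<phi> k (A \<inter> base) (B \<inter> base))
        \<longlonglongrightarrow> measure lborel (A \<inter> base) * measure lborel (B \<inter> base)"
      by (intro \<phi>_level_tendsto) auto
    then show ?thesis by (simp only: \<phi>_Int_base)
  qed
qed

lemma measure_base_sums:
  assumes "range A \<subseteq> sets (rank_one_space C)" "disjoint_family A"
  shows "(\<lambda>i. measure lborel (A i \<inter> base)) sums measure lborel ((\<Union>i. A i) \<inter> base)"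
proof -
  have "emeasure lborel (\<Union>i. A i \<inter> base) \<noteq> \<infinity>"
    by (rule emeasure_subset_level[of _ "C 0" 0]) auto
  moreover have "range (\<lambda>i. A i \<inter> base) \<subseteq> sets lborel"
  proof -
    have "A i \<in> sets (rank_one_space C)" for i using assms(1) by blast
    then have "A i \<in> sets borel" for i by (simp add: sets_iff)
    then show ?thesis by auto
  qed
  moreover have "disjoint_family (\<lambda>i. A i \<inter> base)"
    using assms(2) by (auto simp: disjoint_family_on_def)
  ultimately have "(\<lambda>i. measure lborel (A i \<inter> base)) sums measure lborel (\<Union>i. A i \<inter> base)"
    by (intro measure_UNION)
  moreover have "(\<Union>i. A i) \<inter> base = (\<Union>i. A i \<inter> base)" by blast
  ultimately show ?thesis by (simp only:)
qed

lemma measure_base_null: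
  assumes "A \<in> null_sets (rank_one_space C)"
  shows "measure lborel (A \<inter> base) = 0"
proof -
  have "A \<inter> base \<in> null_sets (rank_one_space C)"
    using assms base_subset by (intro null_set_Int2) (auto simp: sets_iff)
  then have "measure (rank_one_space C) (A \<inter> base) = 0"
    by (simp add: null_sets_def measure_def)
  then show ?thesis using measure_eq[OF le_infI2[OF base_subset]] by simp
qed

text \<open>The extension treats one argument at a time: first \<open>A\<close> is measurable
  against a generator \<open>Y\<close>, then \<open>A\<close> is kept fixed and the second argument
  is extended.\<close>

lemma \<phi>_tendsto:
  assumes "A \<in> sets (rank_one_space C)" "B \<in> sets (rank_one_space C)"
  shows "(\<lambda>k. \<phi> k A B) \<longlonglongrightarrow> measure lborel (A \<inter> base) * measure lborel (B \<inter> base)"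
proof -
  let ?M = "rank_one_space C"
  have borel: "X \<in> sets borel" if "X \<in> sets ?M" for X
    using that by (simp add: sets_iff)
  then have rborel: "range X \<subseteq> sets borel" if "range X \<subseteq> sets ?M" for X :: "nat \<Rightarrow> real set"
    using that by blast
  have gM: "insert (space ?M) (levels C) \<subseteq> sets ?M"
    using generating by (auto simp: generating_semiring_mod_null_def)
  have add1: "(\<lambda>i. \<phi> n (X i) Y) sums \<phi> n (\<Union>i. X i) Y"
    if "Y \<in> sets ?M" "range X \<subseteq> sets ?M" "disjoint_family X" for n X Y
    unfolding \<phi>_def using that borel rborel by (intro sums_divide corr_sums1) auto
  have add2: "(\<lambda>i. \<phi> n Y (X i)) sums \<phi> n Y (\<Union>i. X i)"
    if "Y \<in> sets ?M" "range X \<subseteq> sets ?M" "disjoint_family X" for n X Y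
    unfolding \<phi>_def using that borel rborel by (intro sums_divide corr_sums2) auto
  have gen: "(\<lambda>k. \<phi> k A Y) \<longlonglongrightarrow> measure lborel (A \<inter> base) * measure lborel (Y \<inter> base)"
    if Y: "Y \<in> insert (space ?M) (levels C)" for Y
  proof -
    have YM: "Y \<in> sets ?M" using Y gM by blast
    have "(\<lambda>k. \<phi> k A Y) \<longlonglongrightarrow> measure lborel (Y \<inter> base) * measure lborel (A \<inter> base)"
    proof (rule tendsto_of_generating_semiring[OF generating, where \<nu> = "\<lambda>k X. \<phi> k X Y"
          and m = "\<lambda>X. measure lborel (X \<inter> base)" and c = "2 * real R"
          and \<kappa> = "measure lborel (Y \<inter> base)"])
      show "(\<lambda>k. \<phi> k X Y) \<longlonglongrightarrow> measure lborel (Y \<inter> base) * measure lborel (X \<inter> base)"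
        if "X \<in> insert (space ?M) (levels C)" for X
        using \<phi>_generator_tendsto[OF that Y] by (simp only: mult.commute)
      show "0 \<le> \<phi> n X Y \<and> \<phi> n X Y \<le> 2 * real R * measure lborel (X \<inter> base)"
        if "X \<in> sets ?M" for n X
        using \<phi>_le(1)[OF borel[OF that] borel[OF YM]] \<phi>_nonneg by simp
      show "(\<lambda>i. \<phi> n (X i) Y) sums \<phi> n (\<Union>i. X i) Y"
        if "range X \<subseteq> sets ?M" "disjoint_family X" for n and X :: "nat \<Rightarrow> real set"
        using YM that by (rule add1)
      show "(\<lambda>i. measure lborel (X i \<inter> base)) sums measure lborel ((\<Union>i. X i) \<inter> base)"
        if "range X \<subseteq> sets ?M" "disjoint_family X" for X :: "nat \<Rightarrow> real set"
        using that by (rule measure_base_sums)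
      show "measure lborel (X \<inter> base) = 0" if "X \<in> null_sets ?M" for X
        using that by (rule measure_base_null)
      show "A \<in> sets ?M" by (rule assms(1))
    qed
    then show ?thesis by (simp only: mult.commute)
  qed
  show ?thesis
  proof (rule tendsto_of_generating_semiring[OF generating, where \<nu> = "\<lambda>k X. \<phi> k A X"
        and m = "\<lambda>X. measure lborel (X \<inter> base)" and c = "2 * real R"
        and \<kappa> = "measure lborel (A \<inter> base)"])
    show "0 \<le> \<phi> n A X \<and> \<phi> n A X \<le> 2 * real R * measure lborel (X \<inter> base)"
      if "X \<in> sets ?M" for n X
      using \<phi>_le(2)[OF borel[OF assms(1)] borel[OF that]] \<phi>_nonneg by simp
    show "(\<lambda>i. \<phi> n A (X i)) sums \<phi> n A (\<Union>i. X i)"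
      if "range X \<subseteq> sets ?M" "disjoint_family X" for n and X :: "nat \<Rightarrow> real set"
      using assms(1) that by (rule add2)
    show "(\<lambda>i. measure lborel (X i \<inter> base)) sums measure lborel ((\<Union>i. X i) \<inter> base)"
      if "range X \<subseteq> sets ?M" "disjoint_family X" for X :: "nat \<Rightarrow> real set"
      using that by (rule measure_base_sums)
    show "measure lborel (X \<inter> base) = 0" if "X \<in> null_sets ?M" for X
      using that by (rule measure_base_null)
    show "(\<lambda>k. \<phi> k A Y) \<longlonglongrightarrow> measure lborel (A \<inter> base) * measure lborel (Y \<inter> base)"
      if "Y \<in> insert (space ?M) (levels C)" for Y
      using that by (rule gen)
    show "B \<in> sets ?M" by (rule assms(2))
  qed
qed

text \<open>With the base as \<open>F\<close>, of measure 1, the normalization by the squared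
  measure disappears and the return sequence is \<open>a\<close>.\<close>

lemma weakly_rationally_ergodic: "weakly_rationally_ergodic (rank_one_space C) (rank_one_map C)"
  unfolding weakly_rationally_ergodic_def
proof (intro bexI[of _ base] conjI ballI impI)
  let ?M = "rank_one_space C" and ?T = "rank_one_map C"
  show "base \<in> sets ?M" using base_subset by (simp add: sets_iff)
  have e: "emeasure ?M base = 1"
    using base_subset by (simp add: emeasure_eq base_eq)
  then show "0 < emeasure ?M base" "emeasure ?M base < \<infinity>" by simp_all
  have m: "measure ?M (X \<inter> Y) = measure lborel (X \<inter> Y)" if "X \<subseteq> base" for X Y
    using that base_subset by (intro measure_eq) blast
  have m': "measure ?M X = measure lborel X" if "X \<subseteq> base" for X
    using that base_subset by (intro measure_eq) blast
  fix A B assume AB: "A \<in> sets ?M" "B \<in> sets ?M" "A \<subseteq> base" "B \<subseteq> base"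
  have phi: "1 / return_sequence ?M ?T base k * (\<Sum>i<k. measure ?M (A \<inter> (?T ^^ i) ` B)) = \<phi> k A B" for k
  proof -
    have "measure ?M base = 1" using e by (simp add: measure_def)
    then have "return_sequence ?M ?T base k = a k"
      by (simp add: return_sequence_def intersection_rate_def a_def m[OF subset_refl])
    moreover have "(\<Sum>i<k. measure ?M (A \<inter> (?T ^^ i) ` B)) = corr (stage k) k A B"
      unfolding m[OF AB(3)] using AB(1,2) unfolding sets_iff
      by (intro corr_stage[OF _ _ AB(3,4) le_stage]) auto
    ultimately show ?thesis by (simp add: \<phi>_def)
  qed
  have "A \<inter> base = A" "B \<inter> base = B" using AB(3,4) by auto
  then show "(\<lambda>k. 1 / return_sequence ?M ?T base k * (\<Sum>i<k. measure ?M (A \<inter> (?T ^^ i) ` B)))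
      \<longlonglongrightarrow> measure ?M A * measure ?M B"
    using \<phi>_tendsto[OF AB(1,2)] by (simp only: phi m'[OF AB(3)] m'[OF AB(4)])
qed

end

theorem theorem2p3:
  fixes r :: "nat \<Rightarrow> nat" and s :: "nat \<Rightarrow> nat \<Rightarrow> nat" and C :: "nat \<Rightarrow> column"
  assumes "rank_one_construction r s C"
    and "grows_exponentially r s C"
    and "bounded_cuts r"
  shows "weakly_rationally_ergodic (rank_one_space C) (rank_one_map C)"
proof -
  obtain R where R: "\<And>n. r n \<le> R"
    using assms(3) by (auto simp: bounded_cuts_def bdd_above_def)
  interpret rank_one_exp r s C R
    using assms(1,2) R by unfold_locales
  show ?thesis by (rule weakly_rationally_ergodic)
qed

end
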